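(* Fix $\beta>0$. For each $N\ge2$ let $\xi=\xi^{(N)}=(\xi_{ij})_{1\le i<j\le N}$ be a family of random variables with mean $0$, variance $1$ and $\mathbb{E}|\xi_{ij}|^3\le\bar\tau^3$, where $\bar\tau<\infty$ does not depend on $N,i,j$. Write $V_N=\{(i,j):1\le i<j\le N\}$. Assume that the variables are pairwise uncorrelated, i.e. $\mathrm{Cov}(\xi_v,\xi_w)=0$ for all $v\ne w$ in $V_N$, and that $\xi$ satisfies the following local dependence structure: for each $v\in V_N$ there is $A_v\subset V_N$ such that $(\xi_w)_{w\notin A_v}$ is independent of $\xi_v$, and for each $v\in V_N$ and $w\in A_v$ there is $B_{vw}\subset V_N$ with $A_v\subset B_{vw}$ such that $(\xi_u)_{u\notin B_{vw}}$ is independent of $(\xi_v,\xi_w)$. Let $\eta=\eta_N=\sup_{v\in V_N}\sum_{w\in A_v}|B_{vw}|$ and assume $\eta_N=o(N^{1/2})$ as $N\to\infty$. Then $$\frac1N\,\mathbb{E}\log Z_N(\beta,\xi)\to p_\infty(\beta)\qquad(N\to\infty).$$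
   Context: Sherrington–Kirkpatrick model: for an array $\xi=(\xi_{ij})_{1\le i<j\le N}$ (the environment), define for $\sigma\in\{-1,1\}^N$ $$H_N(\sigma)=\frac{\beta}{\sqrt N}\sum_{i<j}\xi_{ij}\sigma_i\sigma_j,\qquad Z_N(\beta,\xi)=\sum_{\sigma\in\{-1,1\}^N}e^{H_N(\sigma)}.$$ $p_\infty(\beta)$ denotes the limit $\lim_{N\to\infty}\frac1N\mathbb{E}\log Z_N(\beta,g)$ where $g=(g_{ij})_{1\le i<j\le N}$ are independent standard Gaussian random variables; this limit exists by a theorem of Talagrand (it is given by the Parisi formula), which may be taken as known. *)

theory Defs
  imports "HOL-Probability.Probability" "HOL-Library.Landau_Symbols"
begin

definition sk_pairs :: "nat \<Rightarrow> (nat \<times> nat) set" where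
  "sk_pairs N = {(i, j). 1 \<le> i \<and> i < j \<and> j \<le> N}"

definition sk_spins :: "nat \<Rightarrow> (nat \<Rightarrow> real) set" where
  "sk_spins N = {1..N} \<rightarrow>\<^sub>E {- 1, 1}"

definition sk_H :: "nat \<Rightarrow> real \<Rightarrow> (nat \<times> nat \<Rightarrow> real) \<Rightarrow> (nat \<Rightarrow> real) \<Rightarrow> real" where
  "sk_H N \<beta> x \<sigma> = \<beta> / sqrt (real N) * (\<Sum>(i, j)\<in>sk_pairs N. x (i, j) * \<sigma> i * \<sigma> j)"

definition sk_Z :: "nat \<Rightarrow> real \<Rightarrow> (nat \<times> nat \<Rightarrow> real) \<Rightarrow> real" where
  "sk_Z N \<beta> x = (\<Sum>\<sigma>\<in>sk_spins N. exp (sk_H N \<beta> x \<sigma>))"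

definition sk_free_energy ::
  "'a measure \<Rightarrow> nat \<Rightarrow> real \<Rightarrow> (nat \<times> nat \<Rightarrow> 'a \<Rightarrow> real) \<Rightarrow> real" where
  "sk_free_energy M N \<beta> \<xi> = 1 / real N * (\<integral>\<omega>. ln (sk_Z N \<beta> (\<lambda>v. \<xi> v \<omega>)) \<partial>M)"

text \<open>The joint law of the independent standard Gaussian couplings; under it the
  couplings themselves are the coordinate maps.\<close>

definition sk_gauss :: "nat \<Rightarrow> (nat \<times> nat \<Rightarrow> real) measure" where
  "sk_gauss N = (\<Pi>\<^sub>M v\<in>sk_pairs N. density lborel (\<lambda>x. ennreal (std_normal_density x)))"

definition sk_gauss_free_energy :: "real \<Rightarrow> nat \<Rightarrow> real" where
  "sk_gauss_free_energy \<beta> N = sk_free_energy (sk_gauss N) N \<beta> (\<lambda>v g. g v)"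

text \<open>Meaningful only when the sequence converges, since \<open>lim\<close> is otherwise unspecified.\<close>

definition sk_p_infty :: "real \<Rightarrow> real" where
  "sk_p_infty \<beta> = lim (sk_gauss_free_energy \<beta>)"

definition covariance :: "'a measure \<Rightarrow> ('a \<Rightarrow> real) \<Rightarrow> ('a \<Rightarrow> real) \<Rightarrow> real" where
  "covariance M X Y =
    (\<integral>\<omega>. (X \<omega> - (\<integral>\<omega>'. X \<omega>' \<partial>M)) * (Y \<omega> - (\<integral>\<omega>'. Y \<omega>' \<partial>M)) \<partial>M)"

text \<open>Independence of the random vectors \<open>(X\<^sub>i)\<close>, \<open>i \<in> I\<close>, and \<open>(X\<^sub>j)\<close>, \<open>j \<in> J\<close>. A single
  variable or a pair is treated as a vector indexed by a one- or two-element set, because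
  \<open>indep_var\<close> requires both of its variables to take values in the same type.\<close>

definition indep_subfamilies ::
  "'a measure \<Rightarrow> ('i \<Rightarrow> 'a \<Rightarrow> real) \<Rightarrow> 'i set \<Rightarrow> 'i set \<Rightarrow> bool" where
  "indep_subfamilies M X I J \<longleftrightarrow>
    prob_space.indep_var M
      (\<Pi>\<^sub>M i\<in>I. borel) (\<lambda>\<omega>. \<lambda>i\<in>I. X i \<omega>)
      (\<Pi>\<^sub>M j\<in>J. borel) (\<lambda>\<omega>. \<lambda>j\<in>J. X j \<omega>)"

definition local_dependence ::
  "'a measure \<Rightarrow> 'i set \<Rightarrow> ('i \<Rightarrow> 'a \<Rightarrow> real) \<Rightarrow> ('i \<Rightarrow> 'i set) \<Rightarrow> ('i \<Rightarrow> 'i \<Rightarrow> 'i set) \<Rightarrow> bool" where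
  "local_dependence M V X A B \<longleftrightarrow>
    (\<forall>v\<in>V. A v \<subseteq> V \<and> indep_subfamilies M X {v} (V - A v) \<and>
      (\<forall>w\<in>A v. A v \<subseteq> B v w \<and> B v w \<subseteq> V \<and> indep_subfamilies M X {v, w} (V - B v w)))"

definition dependence_size :: "'i set \<Rightarrow> ('i \<Rightarrow> 'i set) \<Rightarrow> ('i \<Rightarrow> 'i \<Rightarrow> 'i set) \<Rightarrow> nat" where
  "dependence_size V A B = (SUP v\<in>V. \<Sum>w\<in>A v. card (B v w))"

end

theory Submission
  imports Defs "HOL-Real_Asymp.Real_Asymp"
begin

text \<open>Smart path: with \<open>g\<close> Gaussian and independent of \<open>\<xi>\<close>, rotate from \<open>g\<close> to \<open>\<xi>\<close> along
  \<open>sin t * \<xi> + cos t * g\<close>. The \<open>t\<close>-derivative of the expected log partition function pairs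
  \<open>\<xi>\<close> and \<open>g\<close> with the gradient of \<open>ln Z\<close>. The Gaussian term is evaluated by integration by
  parts; for \<open>\<xi>\<close> the same identity holds approximately, by Stein's local dependence argument:
  freeze the coordinates in \<open>A\<^sub>v\<close>, respectively \<open>B\<^bsub>vw\<^esub>\<close>, use independence, and pay for the
  freezing with third derivatives. The main terms cancel because the covariances match. Each third
  derivative of \<open>ln Z\<close> is of order \<open>N\<^bsup>-3/2\<^esup>\<close> and at most \<open>N\<^sup>2 * \<eta>\<close> of them enter, so the free
  energies differ by \<open>O(\<eta> / sqrt N)\<close>.\<close>

section \<open>Finite Gibbs measures\<close>

text \<open>\<open>S\<close> is the set of states, \<open>V\<close> indexes the couplings, and
  \<open>a v \<sigma>\<close> is the coefficient of coupling \<open>v\<close> in the energy of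
  \<open>\<sigma>\<close>. Later estimates see the model only through the uniform bound
  \<open>c\<close>, so the factor \<open>N^(-3/2)\<close> will come from
  \<open>c ^ 3\<close>.\<close>

locale gibbs_system =
  fixes S :: "'s set" and V :: "'v set" and a :: "'v \<Rightarrow> 's \<Rightarrow> real" and c :: real
  assumes finite_S: "finite S" and S_nonempty: "S \<noteq> {}"
    and finite_V: "finite V"
    and a_bound: "\<And>v \<sigma>. v \<in> V \<Longrightarrow> \<sigma> \<in> S \<Longrightarrow> \<bar>a v \<sigma>\<bar> \<le> c"
    and c_nonneg: "c \<ge> 0"
begin

definition weight :: "('v \<Rightarrow> real) \<Rightarrow> 's \<Rightarrow> real" where
  "weight x \<sigma> = exp (\<Sum>v\<in>V. x v * a v \<sigma>)"

definition Z :: "('v \<Rightarrow> real) \<Rightarrow> real" where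
  "Z x = (\<Sum>\<sigma>\<in>S. weight x \<sigma>)"

definition avg :: "('v \<Rightarrow> real) \<Rightarrow> ('s \<Rightarrow> real) \<Rightarrow> real" where
  "avg x h = (\<Sum>\<sigma>\<in>S. h \<sigma> * weight x \<sigma>) / Z x"

text \<open>\<open>cov x (a v) (a w)\<close> is the Hessian entry of \<open>ln Z\<close> at
  \<open>x\<close> in the directions \<open>v\<close> and \<open>w\<close>, because
  \<open>avg x (a v)\<close> is its gradient.\<close>

definition cov :: "('v \<Rightarrow> real) \<Rightarrow> ('s \<Rightarrow> real) \<Rightarrow> ('s \<Rightarrow> real) \<Rightarrow> real" where
  "cov x h k = avg x (\<lambda>\<sigma>. h \<sigma> * k \<sigma>) - avg x h * avg x k"

lemma Z_pos: "Z x > 0"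
  unfolding Z_def weight_def using finite_S S_nonempty by (intro sum_pos) auto

lemma weight_cong: "(\<And>v. v \<in> V \<Longrightarrow> x v = y v) \<Longrightarrow> weight x = weight y"
  by (auto simp: weight_def cong: sum.cong)

lemma Z_cong: "(\<And>v. v \<in> V \<Longrightarrow> x v = y v) \<Longrightarrow> Z x = Z y"
  unfolding Z_def using weight_cong[of x y] by simp

text \<open>Allows a vector to be replaced by its restriction to the relevant indices, which is the
  form in which independence is available.\<close>

lemma avg_cong: "(\<And>v. v \<in> V \<Longrightarrow> x v = y v) \<Longrightarrow> avg x h = avg y h"
  unfolding avg_def using weight_cong[of x y] Z_cong[of x y] by simp

lemma abs_avg_le:
  assumes "\<And>\<sigma>. \<sigma> \<in> S \<Longrightarrow> \<bar>h \<sigma>\<bar> \<le> C"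
  shows "\<bar>avg x h\<bar> \<le> C"
proof -
  have "\<bar>\<Sum>\<sigma>\<in>S. h \<sigma> * weight x \<sigma>\<bar> \<le> (\<Sum>\<sigma>\<in>S. C * weight x \<sigma>)"
    by (intro order.trans[OF sum_abs] sum_mono)
      (auto simp: abs_mult weight_def intro!: mult_right_mono assms)
  also have "\<dots> = C * Z x"
    by (simp add: Z_def sum_distrib_left)
  finally show ?thesis
    using Z_pos[of x] by (simp add: avg_def field_simps)
qed

lemma avg_sum: "avg x (\<lambda>\<sigma>. \<Sum>i\<in>I. f i * h i \<sigma>) = (\<Sum>i\<in>I. f i * avg x (h i))"
proof -
  have "(\<Sum>\<sigma>\<in>S. (\<Sum>i\<in>I. f i * h i \<sigma>) * weight x \<sigma>) = (\<Sum>\<sigma>\<in>S. \<Sum>i\<in>I. f i * (h i \<sigma> * weight x \<sigma>))"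
    by (simp add: sum_distrib_right sum_distrib_left mult.assoc)
  also have "\<dots> = (\<Sum>i\<in>I. f i * (\<Sum>\<sigma>\<in>S. h i \<sigma> * weight x \<sigma>))"
    by (subst sum.swap) (simp add: sum_distrib_left)
  finally show ?thesis
    by (simp only: avg_def times_divide_eq_right sum_divide_distrib[symmetric])
qed

lemma cov_sum: "cov x h (\<lambda>\<sigma>. \<Sum>i\<in>I. f i * k i \<sigma>) = (\<Sum>i\<in>I. f i * cov x h (k i))"
proof -
  have "avg x (\<lambda>\<sigma>. h \<sigma> * (\<Sum>i\<in>I. f i * k i \<sigma>)) = (\<Sum>i\<in>I. f i * avg x (\<lambda>\<sigma>. h \<sigma> * k i \<sigma>))"
    using avg_sum[where h = "\<lambda>i \<sigma>. h \<sigma> * k i \<sigma>"]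
    by (simp add: sum_distrib_left mult.left_commute)
  then show ?thesis
    by (simp add: cov_def avg_sum sum_distrib_left sum_subtractf algebra_simps)
qed

section \<open>Derivatives along a path of couplings\<close>

context
  fixes x :: "real \<Rightarrow> 'v \<Rightarrow> real" and x' :: "'v \<Rightarrow> real" and t :: real
  assumes x: "\<And>v. v \<in> V \<Longrightarrow> ((\<lambda>t. x t v) has_real_derivative x' v) (at t)"
begin

text \<open>The path is arbitrary, so that the derivative rules built on this one cover straight
  segments, the variation of a single coordinate and the rotation.\<close>

lemma DERIV_weight:
  "((\<lambda>t. weight (x t) \<sigma>) has_real_derivative (\<Sum>v\<in>V. x' v * a v \<sigma>) * weight (x t) \<sigma>) (at t)"
  unfolding weight_def by (auto intro!: derivative_eq_intros x)

lemma DERIV_Z: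
  "((\<lambda>t. Z (x t)) has_real_derivative (\<Sum>\<sigma>\<in>S. (\<Sum>v\<in>V. x' v * a v \<sigma>) * weight (x t) \<sigma>)) (at t)"
  unfolding Z_def by (intro DERIV_sum DERIV_weight)

lemma DERIV_ln_Z:
  "((\<lambda>t. ln (Z (x t))) has_real_derivative (\<Sum>v\<in>V. x' v * avg (x t) (a v))) (at t)"
proof -
  have "((\<lambda>t. ln (Z (x t))) has_real_derivative
      inverse (Z (x t)) * (\<Sum>\<sigma>\<in>S. (\<Sum>v\<in>V. x' v * a v \<sigma>) * weight (x t) \<sigma>)) (at t)"
    by (rule DERIV_chain2[OF DERIV_ln DERIV_Z]) (rule Z_pos)
  also have "inverse (Z (x t)) * (\<Sum>\<sigma>\<in>S. (\<Sum>v\<in>V. x' v * a v \<sigma>) * weight (x t) \<sigma>)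
      = avg (x t) (\<lambda>\<sigma>. \<Sum>v\<in>V. x' v * a v \<sigma>)"
    by (simp add: avg_def field_simps)
  finally show ?thesis
    by (simp only: avg_sum)
qed

text \<open>In the quotient rule the derivative of the numerator gives the average of a product and
  that of \<open>Z\<close> gives the product of averages; together they form a covariance.\<close>

lemma DERIV_avg:
  "((\<lambda>t. avg (x t) h) has_real_derivative (\<Sum>v\<in>V. x' v * cov (x t) h (a v))) (at t)"
proof -
  let ?k = "\<lambda>\<sigma>. \<Sum>v\<in>V. x' v * a v \<sigma>"
  have "((\<lambda>t. avg (x t) h) has_real_derivative
      ((\<Sum>\<sigma>\<in>S. h \<sigma> * (?k \<sigma> * weight (x t) \<sigma>)) * Z (x t)
        - (\<Sum>\<sigma>\<in>S. h \<sigma> * weight (x t) \<sigma>) * (\<Sum>\<sigma>\<in>S. ?k \<sigma> * weight (x t) \<sigma>))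
      / (Z (x t) * Z (x t))) (at t)"
    unfolding avg_def
    using Z_pos[of "x t"]
    by (intro DERIV_divide DERIV_sum DERIV_cmult DERIV_weight DERIV_Z) auto
  also have "((\<Sum>\<sigma>\<in>S. h \<sigma> * (?k \<sigma> * weight (x t) \<sigma>)) * Z (x t)
        - (\<Sum>\<sigma>\<in>S. h \<sigma> * weight (x t) \<sigma>) * (\<Sum>\<sigma>\<in>S. ?k \<sigma> * weight (x t) \<sigma>))
      / (Z (x t) * Z (x t)) = cov (x t) h ?k"
    using Z_pos[of "x t"] by (simp add: cov_def avg_def mult.assoc diff_divide_distrib)
  finally show ?thesis
    by (simp only: cov_sum)
qed

end

section \<open>Mean value theorem and Lipschitz bounds\<close>

lemma DERIV_segment:
  "((\<lambda>t. y v + t * (x v - y v)) has_real_derivative x v - y v) (at t)" for x y :: "'v \<Rightarrow> real"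
  by (auto intro!: derivative_eq_intros)

text \<open>The partial derivatives of \<open>ln Z\<close> are Gibbs averages of the
  \<open>a v\<close>, hence at most \<open>c\<close> in absolute value. This later gives
  integrability of \<open>ln Z\<close> from first moments of the couplings.\<close>

lemma ln_Z_lipschitz: "\<bar>ln (Z x) - ln (Z y)\<bar> \<le> c * (\<Sum>v\<in>V. \<bar>x v - y v\<bar>)"
proof -
  let ?p = "\<lambda>t v. y v + t * (x v - y v)"
  have "((\<lambda>t. ln (Z (?p t))) has_real_derivative (\<Sum>v\<in>V. (x v - y v) * avg (?p t) (a v))) (at t)" for t
    by (rule DERIV_ln_Z[where x = ?p]) (rule DERIV_segment)
  then obtain t where "ln (Z (?p 1)) - ln (Z (?p 0))
      = (1 - 0) * (\<Sum>v\<in>V. (x v - y v) * avg (?p t) (a v))"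
    using MVT2[OF zero_less_one, where f = "\<lambda>t. ln (Z (?p t))"
        and f' = "\<lambda>t. \<Sum>v\<in>V. (x v - y v) * avg (?p t) (a v)"] by blast
  then have "\<bar>ln (Z x) - ln (Z y)\<bar> = \<bar>\<Sum>v\<in>V. (x v - y v) * avg (?p t) (a v)\<bar>"
    by simp
  also have "\<dots> \<le> (\<Sum>v\<in>V. \<bar>x v - y v\<bar> * c)"
    by (intro order.trans[OF sum_abs] sum_mono)
      (auto simp: abs_mult intro!: mult_left_mono abs_avg_le a_bound)
  finally show ?thesis
    by (simp add: sum_distrib_left mult.commute)
qed

lemma abs_cov_le:
  assumes "\<And>\<sigma>. \<sigma> \<in> S \<Longrightarrow> \<bar>h \<sigma>\<bar> \<le> C" "\<And>\<sigma>. \<sigma> \<in> S \<Longrightarrow> \<bar>k \<sigma>\<bar> \<le> D"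
  shows "\<bar>cov x h k\<bar> \<le> 2 * C * D"
proof -
  obtain \<sigma> where "\<sigma> \<in> S" using S_nonempty by auto
  then have C: "C \<ge> 0"
    using assms(1)[of \<sigma>] by linarith
  have "\<bar>avg x (\<lambda>\<sigma>. h \<sigma> * k \<sigma>)\<bar> \<le> C * D"
    by (intro abs_avg_le) (auto simp: abs_mult intro!: mult_mono assms C)
  moreover have "\<bar>avg x h * avg x k\<bar> \<le> C * D"
    unfolding abs_mult by (intro mult_mono abs_avg_le assms C) auto
  ultimately show ?thesis
    unfolding cov_def by linarith
qed

text \<open>The exact form with an intermediate point is kept, since Stein's argument needs the
  individual first-order terms and not only a bound on their sum.\<close>

lemma avg_mvt:
  "\<exists>t. 0 < t \<and> t < 1 \<and>
    avg x h - avg y h = (\<Sum>v\<in>V. (x v - y v) * cov (\<lambda>v. y v + t * (x v - y v)) h (a v))"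
proof -
  let ?p = "\<lambda>t v. y v + t * (x v - y v)"
  have "((\<lambda>t. avg (?p t) h) has_real_derivative (\<Sum>v\<in>V. (x v - y v) * cov (?p t) h (a v))) (at t)" for t
    by (rule DERIV_avg[where x = ?p]) (rule DERIV_segment)
  then obtain t where "0 < t" "t < 1" "avg (?p 1) h - avg (?p 0) h
      = (1 - 0) * (\<Sum>v\<in>V. (x v - y v) * cov (?p t) h (a v))"
    using MVT2[OF zero_less_one, where f = "\<lambda>t. avg (?p t) h"
        and f' = "\<lambda>t. \<Sum>v\<in>V. (x v - y v) * cov (?p t) h (a v)"] by blast
  then show ?thesis
    by (intro exI[of _ t]) simp
qed

lemma avg_lipschitz:
  assumes "\<And>\<sigma>. \<sigma> \<in> S \<Longrightarrow> \<bar>h \<sigma>\<bar> \<le> C"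
  shows "\<bar>avg x h - avg y h\<bar> \<le> 2 * C * c * (\<Sum>v\<in>V. \<bar>x v - y v\<bar>)"
proof -
  obtain t where "avg x h - avg y h
      = (\<Sum>v\<in>V. (x v - y v) * cov (\<lambda>v. y v + t * (x v - y v)) h (a v))"
    using avg_mvt[of x h y] by blast
  also have "\<bar>\<dots>\<bar> \<le> (\<Sum>v\<in>V. \<bar>x v - y v\<bar> * (2 * C * c))"
    by (intro order.trans[OF sum_abs] sum_mono)
      (auto simp: abs_mult intro!: mult_left_mono abs_cov_le assms a_bound)
  finally show ?thesis
    by (simp add: sum_distrib_left mult.commute)
qed

text \<open>This is the bound on third derivatives of \<open>ln Z\<close>. The average of the
  product \<open>a v * a w\<close> contributes \<open>2 * c ^ 3\<close>; each factor of the product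
  of averages contributes another \<open>2 * c ^ 3\<close>.\<close>

lemma cov_lipschitz:
  assumes "v \<in> V" "w \<in> V"
  shows "\<bar>cov x (a v) (a w) - cov y (a v) (a w)\<bar> \<le> 6 * c ^ 3 * (\<Sum>u\<in>V. \<bar>x u - y u\<bar>)"
proof -
  let ?D = "\<Sum>u\<in>V. \<bar>x u - y u\<bar>"
  have 1: "\<bar>avg x (\<lambda>\<sigma>. a v \<sigma> * a w \<sigma>) - avg y (\<lambda>\<sigma>. a v \<sigma> * a w \<sigma>)\<bar> \<le> 2 * (c * c) * c * ?D"
    by (intro avg_lipschitz) (auto simp: abs_mult intro!: mult_mono a_bound assms c_nonneg)
  have "?D \<ge> 0"
    by (intro sum_nonneg) auto
  then have *: "\<bar>(avg x (a i) - avg y (a i)) * avg z (a j)\<bar> \<le> (2 * c * c * ?D) * c"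
    if "i \<in> V" "j \<in> V" for i j z
    unfolding abs_mult
  proof (intro mult_mono)
    show "\<bar>avg x (a i) - avg y (a i)\<bar> \<le> 2 * c * c * ?D"
      by (rule avg_lipschitz) (rule a_bound[OF that(1)])
    show "\<bar>avg z (a j)\<bar> \<le> c"
      by (rule abs_avg_le) (rule a_bound[OF that(2)])
  qed (use c_nonneg in auto)
  \<comment> \<open>The difference of two products is telescoped, changing one factor at a
    time.\<close>
  have "\<bar>(avg x (a v) - avg y (a v)) * avg x (a w) + (avg x (a w) - avg y (a w)) * avg y (a v)\<bar>
      \<le> (2 * c * c * ?D) * c + (2 * c * c * ?D) * c"
    by (intro order.trans[OF abs_triangle_ineq] add_mono * assms)
  moreover have "(avg x (a v) - avg y (a v)) * avg x (a w) + (avg x (a w) - avg y (a w)) * avg y (a v)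
      = avg x (a v) * avg x (a w) - avg y (a v) * avg y (a w)"
    by (simp add: algebra_simps)
  moreover have "2 * c * c * d * c + 2 * c * c * d * c = 4 * c ^ 3 * d" for d
    by (simp add: power3_eq_cube)
  ultimately have 2: "\<bar>avg x (a v) * avg x (a w) - avg y (a v) * avg y (a w)\<bar> \<le> 4 * c ^ 3 * ?D"
    by (simp only:)
  have "2 * (c * c) * c * ?D = 2 * c ^ 3 * ?D"
    by (simp add: power3_eq_cube)
  with 1 have 1: "\<bar>avg x (\<lambda>\<sigma>. a v \<sigma> * a w \<sigma>) - avg y (\<lambda>\<sigma>. a v \<sigma> * a w \<sigma>)\<bar> \<le> 2 * c ^ 3 * ?D"
    by simp
  have "\<bar>p - q - (r - s)\<bar> \<le> 6 * c ^ 3 * d"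
    if "\<bar>p - r\<bar> \<le> 2 * c ^ 3 * d" "\<bar>q - s\<bar> \<le> 4 * c ^ 3 * d" for p q r s d :: real
    using that by linarith
  from this[OF 1 2] show ?thesis
    unfolding cov_def .
qed

section \<open>Measurability in random couplings\<close>

lemma measurable_Z:
  assumes [measurable]: "\<And>v. v \<in> V \<Longrightarrow> (\<lambda>\<omega>. X \<omega> v) \<in> borel_measurable M"
  shows "(\<lambda>\<omega>. Z (X \<omega>)) \<in> borel_measurable M"
  unfolding Z_def weight_def by measurable

lemma measurable_avg:
  assumes [measurable]: "\<And>v. v \<in> V \<Longrightarrow> (\<lambda>\<omega>. X \<omega> v) \<in> borel_measurable M"
  shows "(\<lambda>\<omega>. avg (X \<omega>) h) \<in> borel_measurable M"
  unfolding avg_def Z_def weight_def by measurable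

lemma measurable_cov:
  assumes "\<And>v. v \<in> V \<Longrightarrow> (\<lambda>\<omega>. X \<omega> v) \<in> borel_measurable M"
  shows "(\<lambda>\<omega>. cov (X \<omega>) h k) \<in> borel_measurable M"
  unfolding cov_def
  by (intro borel_measurable_diff borel_measurable_times measurable_avg assms)

end

section \<open>Gaussian and probabilistic preliminaries\<close>

definition std_normal :: "real measure" where
  "std_normal = density lborel (\<lambda>x. ennreal (std_normal_density x))"

lemma prob_space_std_normal: "prob_space std_normal"
  unfolding std_normal_def by (rule prob_space_normal_density) simp

lemma sets_std_normal [measurable_cong, simp]: "sets std_normal = sets borel"
  by (simp add: std_normal_def)

lemma space_std_normal [simp]: "space std_normal = UNIV"
  by (simp add: std_normal_def)

lemma integrable_std_normal: "integrable std_normal (\<lambda>x. x)"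
  using integrable_std_normal_moment[of 1] by (simp add: std_normal_def integrable_density)

lemma std_normal_density_tendsto_0:
  "(std_normal_density \<longlongrightarrow> 0) at_top" "(std_normal_density \<longlongrightarrow> 0) at_bot"
  unfolding std_normal_density_def by real_asymp+

text \<open>The density \<open>\<phi>\<close> satisfies \<open>\<phi>' x = - x * \<phi> x\<close>,
  so \<open>\<phi> * h\<close> has derivative \<open>\<phi> * h' - x * \<phi> * h\<close>. Its
  integral over the line vanishes because \<open>h\<close> is bounded and \<open>\<phi>\<close>
  tends to 0 at both ends.\<close>

lemma gaussian_integration_by_parts:
  fixes h h' :: "real \<Rightarrow> real"
  assumes h: "\<And>x. (h has_real_derivative h' x) (at x)" and h': "\<And>x. isCont h' x"
    and bound: "\<And>x. \<bar>h x\<bar> \<le> K" "\<And>x. \<bar>h' x\<bar> \<le> L"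
  shows "(\<integral>x. x * h x \<partial>std_normal) = (\<integral>x. h' x \<partial>std_normal)"
proof -
  have isCont_h: "isCont h x" for x
    using h by (rule DERIV_isCont)
  have [measurable]: "h \<in> borel_measurable borel" "h' \<in> borel_measurable borel"
    using isCont_h h' by (auto intro!: borel_measurable_continuous_onI simp: continuous_at_imp_continuous_on)
  have int1: "integrable lborel (\<lambda>x. std_normal_density x * (x * h x))"
  proof (rule Bochner_Integration.integrable_bound)
    show "integrable lborel (\<lambda>x. K * (std_normal_density x * \<bar>x\<bar> ^ 1))"
      by (intro integrable_mult_right integrable_std_normal_moment_abs)
    have "std_normal_density x * \<bar>x\<bar> * \<bar>h x\<bar> \<le> std_normal_density x * \<bar>x\<bar> * K" for x
      by (intro mult_left_mono bound) auto
    then show "AE x in lborel. norm (std_normal_density x * (x * h x))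
        \<le> norm (K * (std_normal_density x * \<bar>x\<bar> ^ 1))"
      using order.trans[OF abs_ge_zero bound(1)] by (auto simp: abs_mult mult_ac)
  qed measurable
  have int2: "integrable lborel (\<lambda>x. std_normal_density x * h' x)"
  proof (rule Bochner_Integration.integrable_bound)
    show "integrable lborel (\<lambda>x. L * (std_normal_density x * \<bar>x\<bar> ^ 0))"
      by (intro integrable_mult_right integrable_std_normal_moment_abs)
    have "std_normal_density x * \<bar>h' x\<bar> \<le> std_normal_density x * L" for x
      by (intro mult_left_mono bound) auto
    then show "AE x in lborel. norm (std_normal_density x * h' x)
        \<le> norm (L * (std_normal_density x * \<bar>x\<bar> ^ 0))"
      using order.trans[OF abs_ge_zero bound(2)] by (auto simp: abs_mult mult_ac)
  qed measurable
  let ?f = "\<lambda>x. std_normal_density x * h' x - std_normal_density x * (x * h x)"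
  have lim: "((\<lambda>x. std_normal_density x * h x) \<longlongrightarrow> 0) F"
    if "(std_normal_density \<longlongrightarrow> 0) F" for F
  proof (rule Lim_null_comparison)
    show "((\<lambda>x. K * std_normal_density x) \<longlongrightarrow> 0) F"
      using tendsto_mult_left[OF that, of K] by simp
    have "std_normal_density x * \<bar>h x\<bar> \<le> std_normal_density x * K" for x
      by (intro mult_left_mono bound) auto
    then show "\<forall>\<^sub>F x in F. norm (std_normal_density x * h x) \<le> K * std_normal_density x"
      by (auto simp: abs_mult mult_ac)
  qed
  \<comment> \<open>The two zeros are the limits of \<open>std_normal_density x * h x\<close> at the
    two ends of the line.\<close>
  have "(LBINT x=-\<infinity>..\<infinity>. ?f x) = 0 - 0"
  proof (rule interval_integral_FTC_integrable[where F = "\<lambda>x. std_normal_density x * h x"])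
    have "((\<lambda>x. exp (- x\<^sup>2 / 2)) has_real_derivative - x * exp (- x\<^sup>2 / 2)) (at x)" for x :: real
      by (auto intro!: derivative_eq_intros)
    then have "(std_normal_density has_real_derivative - x * std_normal_density x) (at x)" for x
      unfolding std_normal_density_def mult.left_commute[of "- x"] by (rule DERIV_cmult)
    then have "((\<lambda>x. std_normal_density x * h x) has_real_derivative ?f x) (at x)" for x
      by (rule derivative_eq_intros) (auto intro: h)
    then show "((\<lambda>x. std_normal_density x * h x) has_vector_derivative ?f x) (at x)" for x
      by (simp add: has_real_derivative_iff_has_vector_derivative)
    show "isCont ?f x" for x
      unfolding std_normal_density_def by (intro continuous_intros isCont_h h') auto
    show "set_integrable lborel (einterval (- \<infinity>) \<infinity>) ?f"
      using int1 int2 by (simp add: set_integrable_def einterval_def)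
    show "(((\<lambda>x. std_normal_density x * h x) \<circ> real_of_ereal) \<longlongrightarrow> 0) (at_right (- \<infinity>))"
      "(((\<lambda>x. std_normal_density x * h x) \<circ> real_of_ereal) \<longlongrightarrow> 0) (at_left \<infinity>)"
      using lim[OF std_normal_density_tendsto_0(1)] lim[OF std_normal_density_tendsto_0(2)]
      by (simp_all add: ereal_tendsto_simps1)
  qed auto
  then have "(\<integral>x. ?f x \<partial>lborel) = 0"
    by (simp add: interval_lebesgue_integral_def set_lebesgue_integral_def einterval_def)
  then have "(\<integral>x. std_normal_density x * (x * h x) \<partial>lborel) = (\<integral>x. std_normal_density x * h' x \<partial>lborel)"
    using int1 int2 by simp
  then show ?thesis
    unfolding std_normal_def by (simp add: integral_density)
qed

lemma integrable_std_normal_component: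
  assumes "v \<in> V"
  shows "integrable (\<Pi>\<^sub>M v\<in>V. std_normal) (\<lambda>g. g v)"
proof -
  have "distr (\<Pi>\<^sub>M v\<in>V. std_normal) std_normal (\<lambda>g. g v) = std_normal"
    using assms prob_space_std_normal by (intro distr_PiM_component) auto
  then have "integrable (distr (\<Pi>\<^sub>M v\<in>V. std_normal) std_normal (\<lambda>g. g v)) (\<lambda>x. x)"
    using integrable_std_normal by simp
  then show ?thesis
    using assms by (subst (asm) integrable_distr_eq) auto
qed

text \<open>Fubini isolates coordinate \<open>v\<close>; the one-dimensional identity is then
  applied with all other coordinates fixed.\<close>

lemma gaussian_integration_by_parts_PiM:
  fixes F F' :: "('v \<Rightarrow> real) \<Rightarrow> real"
  assumes V: "finite V" "v \<in> V"
    and F: "\<And>g x. ((\<lambda>t. F (g(v := t))) has_real_derivative F' (g(v := x))) (at x)"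
    and F': "\<And>g x. isCont (\<lambda>t. F' (g(v := t))) x"
    and bound: "\<And>g. \<bar>F g\<bar> \<le> K" "\<And>g. \<bar>F' g\<bar> \<le> L"
    and [measurable]: "F \<in> borel_measurable (\<Pi>\<^sub>M v\<in>V. std_normal)"
      "F' \<in> borel_measurable (\<Pi>\<^sub>M v\<in>V. std_normal)"
  shows "(\<integral>g. g v * F g \<partial>(\<Pi>\<^sub>M v\<in>V. std_normal)) = (\<integral>g. F' g \<partial>(\<Pi>\<^sub>M v\<in>V. std_normal))"
proof -
  interpret std_normal: prob_space std_normal
    by (rule prob_space_std_normal)
  interpret product_prob_space "\<lambda>_. std_normal" V
    by standard
  have V': "insert v (V - {v}) = V"
    using V by auto
  have int: "integrable (\<Pi>\<^sub>M v\<in>V. std_normal) (\<lambda>g. g v * F g)"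
  proof (rule Bochner_Integration.integrable_bound)
    show "integrable (\<Pi>\<^sub>M v\<in>V. std_normal) (\<lambda>g. g v * K)"
      using V by (intro integrable_mult_left integrable_std_normal_component) auto
    show "AE g in \<Pi>\<^sub>M v\<in>V. std_normal. norm (g v * F g) \<le> norm (g v * K)"
      using order.trans[OF abs_ge_zero bound(1)] bound(1)
      by (auto simp: abs_mult intro!: mult_left_mono)
    show "(\<lambda>g. g v * F g) \<in> borel_measurable (\<Pi>\<^sub>M v\<in>V. std_normal)"
      using V by measurable
  qed
  have int': "integrable (\<Pi>\<^sub>M v\<in>V. std_normal) F'"
    using bound by (intro P.integrable_const_bound[where B = L]) auto
  have "(\<integral>g. g v * F g \<partial>(\<Pi>\<^sub>M v\<in>V. std_normal))
      = (\<integral>g. \<integral>t. t * F (g(v := t)) \<partial>std_normal \<partial>(\<Pi>\<^sub>M v\<in>V - {v}. std_normal))"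
    using product_integral_insert[of "V - {v}" v "\<lambda>g. g v * F g", unfolded V'] V int by simp
  also have "\<dots> = (\<integral>g. \<integral>t. F' (g(v := t)) \<partial>std_normal \<partial>(\<Pi>\<^sub>M v\<in>V - {v}. std_normal))"
    by (rule Bochner_Integration.integral_cong[OF refl],
        rule gaussian_integration_by_parts[OF F F' bound])
  also have "\<dots> = (\<integral>g. F' g \<partial>(\<Pi>\<^sub>M v\<in>V. std_normal))"
    using product_integral_insert[of "V - {v}" v F', unfolded V'] V int' by simp
  finally show ?thesis .
qed

text \<open>Testing the limit along sequences makes dominated convergence applicable. By the mean
  value inequality, a bound \<open>w\<close> on the derivative that is uniform in \<open>t\<close>
  also dominates every difference quotient.\<close>

lemma has_real_derivative_integral:
  fixes u u' :: "real \<Rightarrow> 'a \<Rightarrow> real"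
  assumes int: "\<And>t. integrable M (u t)"
    and meas: "\<And>t. u' t \<in> borel_measurable M"
    and deriv: "\<And>t \<omega>. \<omega> \<in> space M \<Longrightarrow> ((\<lambda>t. u t \<omega>) has_real_derivative u' t \<omega>) (at t)"
    and bound: "\<And>t \<omega>. \<omega> \<in> space M \<Longrightarrow> \<bar>u' t \<omega>\<bar> \<le> w \<omega>" and w: "integrable M w"
  shows "((\<lambda>t. \<integral>\<omega>. u t \<omega> \<partial>M) has_real_derivative (\<integral>\<omega>. u' t \<omega> \<partial>M)) (at t)"
  unfolding has_field_derivative_iff tendsto_at_iff_sequentially comp_def
proof (intro allI impI)
  fix X :: "nat \<Rightarrow> real"
  assume X: "\<forall>i. X i \<in> UNIV - {t}" "X \<longlonglongrightarrow> t"
  note [measurable] = borel_measurable_integrable[OF int] meas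
  have "(\<lambda>i. \<integral>\<omega>. (u (X i) \<omega> - u t \<omega>) / (X i - t) \<partial>M) \<longlonglongrightarrow> (\<integral>\<omega>. u' t \<omega> \<partial>M)"
  proof (rule integral_dominated_convergence)
    show "AE \<omega> in M. (\<lambda>i. (u (X i) \<omega> - u t \<omega>) / (X i - t)) \<longlonglongrightarrow> u' t \<omega>"
      using deriv X unfolding has_field_derivative_iff tendsto_at_iff_sequentially comp_def by auto
    show "AE \<omega> in M. norm ((u (X i) \<omega> - u t \<omega>) / (X i - t)) \<le> w \<omega>" for i
    proof (rule AE_I2)
      fix \<omega> assume \<omega>: "\<omega> \<in> space M"
      have "norm (u (X i) \<omega> - u t \<omega>) \<le> w \<omega> * norm (X i - t)"
        by (rule field_differentiable_bound[of UNIV "\<lambda>t. u t \<omega>" "\<lambda>t. u' t \<omega>"])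
          (use deriv[OF \<omega>] bound[OF \<omega>] in auto)
      then show "norm ((u (X i) \<omega> - u t \<omega>) / (X i - t)) \<le> w \<omega>"
        using X(1) by (simp add: field_simps)
    qed
  qed (use w in measurable)
  then show "(\<lambda>i. ((\<integral>\<omega>. u (X i) \<omega> \<partial>M) - (\<integral>\<omega>. u t \<omega> \<partial>M)) / (X i - t)) \<longlonglongrightarrow> (\<integral>\<omega>. u' t \<omega> \<partial>M)"
    using int by simp
qed

text \<open>Turns independence of two subfamilies into factorisation of expectations, for functions
  that read only the restricted vectors.\<close>

lemma indep_subfamilies_expectation_mult:
  fixes f h :: "('i \<Rightarrow> real) \<Rightarrow> real"
  assumes "prob_space M" and indep: "indep_subfamilies M X I J"
    and f: "f \<in> borel_measurable (\<Pi>\<^sub>M i\<in>I. borel)" and h: "h \<in> borel_measurable (\<Pi>\<^sub>M j\<in>J. borel)"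
    and int: "integrable M (\<lambda>\<omega>. f (\<lambda>i\<in>I. X i \<omega>))" "integrable M (\<lambda>\<omega>. h (\<lambda>j\<in>J. X j \<omega>))"
  shows "(\<integral>\<omega>. f (\<lambda>i\<in>I. X i \<omega>) * h (\<lambda>j\<in>J. X j \<omega>) \<partial>M)
      = (\<integral>\<omega>. f (\<lambda>i\<in>I. X i \<omega>) \<partial>M) * (\<integral>\<omega>. h (\<lambda>j\<in>J. X j \<omega>) \<partial>M)"
proof -
  interpret prob_space M by fact
  have "indep_var borel (f \<circ> (\<lambda>\<omega>. \<lambda>i\<in>I. X i \<omega>)) borel (h \<circ> (\<lambda>\<omega>. \<lambda>j\<in>J. X j \<omega>))"
    using indep f h unfolding indep_subfamilies_def by (rule indep_var_compose)
  then show ?thesis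
    using int unfolding comp_def by (rule indep_var_lebesgue_integral)
qed

text \<open>The inequality between arithmetic and geometric means, through the classical
  factorisation of \<open>x ^ 3 + y ^ 3 + z ^ 3 - 3 * (x * y * z)\<close>. It reduces mixed third
  moments to pure ones.\<close>

lemma mult3_le_sum_cubes:
  fixes x y z :: real
  assumes "x \<ge> 0" "y \<ge> 0" "z \<ge> 0"
  shows "3 * (x * y * z) \<le> x ^ 3 + y ^ 3 + z ^ 3"
proof -
  have "x ^ 3 + y ^ 3 + z ^ 3 - 3 * (x * y * z)
      = (x + y + z) * ((x - y)\<^sup>2 + (y - z)\<^sup>2 + (x - z)\<^sup>2) / 2"
    by (simp add: power2_eq_square power3_eq_cube algebra_simps)
  also have "\<dots> \<ge> 0"
    using assms by simp
  finally show ?thesis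
    by simp
qed

section \<open>Locally dependent couplings\<close>

text \<open>Since the means vanish, variance and covariance are recorded as raw second moments.
  \<open>K\<close> bounds the absolute third moments.\<close>

locale dependent_gibbs_system = gibbs_system S V a c + prob_space M
  for S :: "'s set" and V :: "'v set" and a :: "'v \<Rightarrow> 's \<Rightarrow> real" and c :: real
    and M :: "'a measure" +
  fixes \<xi> :: "'v \<Rightarrow> 'a \<Rightarrow> real" and A :: "'v \<Rightarrow> 'v set" and B :: "'v \<Rightarrow> 'v \<Rightarrow> 'v set" and K :: real
  assumes measurable_\<xi> [measurable]: "\<And>v. v \<in> V \<Longrightarrow> \<xi> v \<in> borel_measurable M"
    and integrable_\<xi>: "\<And>v. v \<in> V \<Longrightarrow> integrable M (\<xi> v)"
    and mean_\<xi>: "\<And>v. v \<in> V \<Longrightarrow> expectation (\<xi> v) = 0"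
    and second_moment_\<xi>: "\<And>v. v \<in> V \<Longrightarrow> expectation (\<lambda>\<omega>. \<xi> v \<omega> * \<xi> v \<omega>) = 1"
    and uncorrelated_\<xi>: "\<And>v w. v \<in> V \<Longrightarrow> w \<in> V \<Longrightarrow> v \<noteq> w \<Longrightarrow> expectation (\<lambda>\<omega>. \<xi> v \<omega> * \<xi> w \<omega>) = 0"
    and integrable_cube: "\<And>v. v \<in> V \<Longrightarrow> integrable M (\<lambda>\<omega>. \<bar>\<xi> v \<omega>\<bar> ^ 3)"
    and third_moment_\<xi>: "\<And>v. v \<in> V \<Longrightarrow> expectation (\<lambda>\<omega>. \<bar>\<xi> v \<omega>\<bar> ^ 3) \<le> K"
    and local_dep: "local_dependence M V \<xi> A B"
begin

lemma A_subset: "v \<in> V \<Longrightarrow> A v \<subseteq> V"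
  and B_subset: "v \<in> V \<Longrightarrow> w \<in> A v \<Longrightarrow> B v w \<subseteq> V"
  and A_subset_B: "v \<in> V \<Longrightarrow> w \<in> A v \<Longrightarrow> A v \<subseteq> B v w"
  and indep_A: "v \<in> V \<Longrightarrow> indep_subfamilies M \<xi> {v} (V - A v)"
  and indep_B: "v \<in> V \<Longrightarrow> w \<in> A v \<Longrightarrow> indep_subfamilies M \<xi> {v, w} (V - B v w)"
  using local_dep unfolding local_dependence_def by blast+

section \<open>Moment bounds and independence after freezing\<close>

lemma integrable_mult2:
  assumes "v \<in> V" "w \<in> V"
  shows "integrable M (\<lambda>\<omega>. \<xi> v \<omega> * \<xi> w \<omega>)"
proof (rule Bochner_Integration.integrable_bound)
  show "integrable M (\<lambda>\<omega>. \<bar>\<xi> v \<omega>\<bar> ^ 3 + \<bar>\<xi> w \<omega>\<bar> ^ 3 + 1)"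
    using assms by (intro Bochner_Integration.integrable_add integrable_cube) auto
  have "3 * (\<bar>\<xi> v \<omega>\<bar> * \<bar>\<xi> w \<omega>\<bar>) \<le> \<bar>\<xi> v \<omega>\<bar> ^ 3 + \<bar>\<xi> w \<omega>\<bar> ^ 3 + 1" for \<omega>
    using mult3_le_sum_cubes[of "\<bar>\<xi> v \<omega>\<bar>" "\<bar>\<xi> w \<omega>\<bar>" 1] by simp
  then have "\<bar>\<xi> v \<omega>\<bar> * \<bar>\<xi> w \<omega>\<bar> \<le> \<bar>\<xi> v \<omega>\<bar> ^ 3 + \<bar>\<xi> w \<omega>\<bar> ^ 3 + 1" for \<omega>
    by (rule order.trans[rotated]) simp
  then show "AE \<omega> in M. norm (\<xi> v \<omega> * \<xi> w \<omega>) \<le> norm (\<bar>\<xi> v \<omega>\<bar> ^ 3 + \<bar>\<xi> w \<omega>\<bar> ^ 3 + 1)"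
    by (auto simp: abs_mult intro: order.trans[OF _ abs_ge_self])
qed (use assms in measurable)

text \<open>The mean of three cubes dominates the product, so the bound \<open>K\<close> carries
  over without a larger constant and without any independence.\<close>

lemma expectation_abs_mult3:
  assumes "u \<in> V" "v \<in> V" "w \<in> V"
  shows "integrable M (\<lambda>\<omega>. \<bar>\<xi> u \<omega> * \<xi> v \<omega> * \<xi> w \<omega>\<bar>)"
    and "expectation (\<lambda>\<omega>. \<bar>\<xi> u \<omega> * \<xi> v \<omega> * \<xi> w \<omega>\<bar>) \<le> K"
proof -
  let ?s = "\<lambda>\<omega>. (\<bar>\<xi> u \<omega>\<bar> ^ 3 + \<bar>\<xi> v \<omega>\<bar> ^ 3 + \<bar>\<xi> w \<omega>\<bar> ^ 3) / 3"
  have s: "integrable M ?s"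
    using assms by (intro integrable_divide Bochner_Integration.integrable_add integrable_cube)
  have le: "\<bar>\<xi> u \<omega> * \<xi> v \<omega> * \<xi> w \<omega>\<bar> \<le> ?s \<omega>" for \<omega>
    using mult3_le_sum_cubes[of "\<bar>\<xi> u \<omega>\<bar>" "\<bar>\<xi> v \<omega>\<bar>" "\<bar>\<xi> w \<omega>\<bar>"] by (simp add: abs_mult)
  show int: "integrable M (\<lambda>\<omega>. \<bar>\<xi> u \<omega> * \<xi> v \<omega> * \<xi> w \<omega>\<bar>)"
  proof (rule Bochner_Integration.integrable_bound[OF s])
    show "AE \<omega> in M. norm \<bar>\<xi> u \<omega> * \<xi> v \<omega> * \<xi> w \<omega>\<bar> \<le> norm (?s \<omega>)"
      using le by (auto intro: order.trans[OF _ abs_ge_self])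
  qed (use assms in measurable)
  have "expectation (\<lambda>\<omega>. \<bar>\<xi> u \<omega> * \<xi> v \<omega> * \<xi> w \<omega>\<bar>) \<le> expectation ?s"
    using int s le by (intro integral_mono)
  also have "\<dots> = (expectation (\<lambda>\<omega>. \<bar>\<xi> u \<omega>\<bar> ^ 3) + expectation (\<lambda>\<omega>. \<bar>\<xi> v \<omega>\<bar> ^ 3)
      + expectation (\<lambda>\<omega>. \<bar>\<xi> w \<omega>\<bar> ^ 3)) / 3"
    using assms integrable_cube by simp
  also have "\<dots> \<le> K"
    using third_moment_\<xi>[OF assms(1)] third_moment_\<xi>[OF assms(2)] third_moment_\<xi>[OF assms(3)] by simp
  finally show "expectation (\<lambda>\<omega>. \<bar>\<xi> u \<omega> * \<xi> v \<omega> * \<xi> w \<omega>\<bar>) \<le> K" .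
qed

text \<open>Unit second moment suffices, since \<open>\<bar>x\<bar>\<close> is at most
  \<open>(1 + x * x) / 2\<close>.\<close>

lemma expectation_abs_le_1:
  assumes "v \<in> V"
  shows "expectation (\<lambda>\<omega>. \<bar>\<xi> v \<omega>\<bar>) \<le> 1"
proof -
  have "\<bar>x\<bar> \<le> (1 + x * x) / 2" for x :: real
    using zero_le_power2[of "\<bar>x\<bar> - 1"] by (simp add: power2_eq_square algebra_simps)
  then have "expectation (\<lambda>\<omega>. \<bar>\<xi> v \<omega>\<bar>) \<le> expectation (\<lambda>\<omega>. (1 + \<xi> v \<omega> * \<xi> v \<omega>) / 2)"
    using assms by (intro integral_mono integrable_abs integrable_\<xi> integrable_divide
        Bochner_Integration.integrable_add integrable_mult2) auto
  also have "\<dots> = 1"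
    using assms by (simp add: integrable_mult2 second_moment_\<xi> prob_space)
  finally show ?thesis .
qed

text \<open>Otherwise \<open>\<xi> v\<close> would be independent of a family containing itself, and
  its second moment would be the square of its mean, that is 0 instead of 1. This guarantees that
  the diagonal term \<open>w = v\<close> occurs in sums over \<open>A v\<close>.\<close>

lemma self_mem_A:
  assumes "v \<in> V"
  shows "v \<in> A v"
proof (rule ccontr)
  assume "v \<notin> A v"
  with assms have "expectation (\<lambda>\<omega>. (\<lambda>i\<in>{v}. \<xi> i \<omega>) v * (\<lambda>i\<in>V - A v. \<xi> i \<omega>) v)
      = expectation (\<lambda>\<omega>. (\<lambda>i\<in>{v}. \<xi> i \<omega>) v) * expectation (\<lambda>\<omega>. (\<lambda>i\<in>V - A v. \<xi> i \<omega>) v)"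
    by (intro indep_subfamilies_expectation_mult[OF prob_space_axioms indep_A]
        measurable_component_singleton) (auto intro: integrable_\<xi>)
  then show False
    using assms \<open>v \<notin> A v\<close> second_moment_\<xi>[of v] mean_\<xi>[of v] by simp
qed

text \<open>Freezing the coordinates in \<open>D\<close>: their contribution \<open>r * x u\<close>
  is dropped and only the base point \<open>y\<close> is kept, so the result depends on
  \<open>x\<close> only outside \<open>D\<close>. Later \<open>y\<close> is \<open>cos t * g\<close>
  and \<open>r\<close> is \<open>sin t\<close>; \<open>D = {}\<close> freezes nothing.\<close>

definition masked :: "('v \<Rightarrow> real) \<Rightarrow> real \<Rightarrow> 'v set \<Rightarrow> ('v \<Rightarrow> real) \<Rightarrow> 'v \<Rightarrow> real" where
  "masked y r D x = (\<lambda>u. if u \<in> D then y u else y u + r * x u)"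

lemma masked_restrict: "v \<in> V \<Longrightarrow> masked y r D (\<lambda>i\<in>V - D. x i) v = masked y r D x v"
  by (simp add: masked_def)

lemma measurable_masked:
  "v \<in> V \<Longrightarrow> (\<lambda>x. masked y r D x v) \<in> borel_measurable (\<Pi>\<^sub>M i\<in>V - D. borel)"
  by (cases "v \<in> D") (auto simp: masked_def intro!: borel_measurable_add borel_measurable_times
      measurable_component_singleton)

lemma measurable_masked_\<xi>:
  "v \<in> V \<Longrightarrow> (\<lambda>\<omega>. masked y r D (\<lambda>v. \<xi> v \<omega>) v) \<in> borel_measurable M"
  by (cases "v \<in> D") (auto simp: masked_def)

text \<open>With \<open>A v\<close> frozen, the average is a function of couplings independent of
  \<open>\<xi> v\<close>, so the expectation factorises and the mean of \<open>\<xi> v\<close> is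
  0.\<close>

lemma expectation_avg_masked:
  assumes v: "v \<in> V"
  shows "expectation (\<lambda>\<omega>. \<xi> v \<omega> * avg (masked y r (A v) (\<lambda>u. \<xi> u \<omega>)) (a v)) = 0"
proof -
  let ?F = "\<lambda>x. avg (masked y r (A v) x) (a v)"
  have F: "?F (\<lambda>i\<in>V - A v. \<xi> i \<omega>) = ?F (\<lambda>u. \<xi> u \<omega>)" for \<omega>
    by (intro avg_cong masked_restrict)
  have int: "integrable M (\<lambda>\<omega>. ?F (\<lambda>i\<in>V - A v. \<xi> i \<omega>))"
    unfolding F using v
    by (intro integrable_const_bound[where B = c] AE_I2 measurable_avg measurable_masked_\<xi>)
      (auto intro!: abs_avg_le a_bound)
  have "expectation (\<lambda>\<omega>. (\<lambda>i\<in>{v}. \<xi> i \<omega>) v * ?F (\<lambda>i\<in>V - A v. \<xi> i \<omega>))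
      = expectation (\<lambda>\<omega>. (\<lambda>i\<in>{v}. \<xi> i \<omega>) v) * expectation (\<lambda>\<omega>. ?F (\<lambda>i\<in>V - A v. \<xi> i \<omega>))"
    using v
    by (intro indep_subfamilies_expectation_mult[OF prob_space_axioms indep_A]
        measurable_component_singleton measurable_avg measurable_masked int) (simp_all add: integrable_\<xi>)
  then show ?thesis
    using v by (simp add: F mean_\<xi>)
qed

lemma integrable_cov:
  assumes "v \<in> V" "w \<in> V" "\<And>v. v \<in> V \<Longrightarrow> (\<lambda>\<omega>. X \<omega> v) \<in> borel_measurable M"
  shows "integrable M (\<lambda>\<omega>. cov (X \<omega>) (a v) (a w))"
  using assms
  by (intro integrable_const_bound[where B = "2 * c * c"] AE_I2 measurable_cov)
    (auto intro!: abs_cov_le a_bound)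

text \<open>With \<open>B v w\<close> frozen, the covariance separates from the pair, leaving the
  factor \<open>expectation (\<lambda>\<omega>. \<xi> v \<omega> * \<xi> w \<omega>)\<close>. This
  is 1 on the diagonal and 0 off it, exactly as for independent Gaussians.\<close>

lemma
  assumes v: "v \<in> V" and w: "w \<in> A v"
  shows expectation_cov_masked: "expectation (\<lambda>\<omega>. \<xi> v \<omega> * \<xi> w \<omega> * cov (masked y r (B v w) (\<lambda>u. \<xi> u \<omega>)) (a v) (a w))
      = (if v = w then expectation (\<lambda>\<omega>. cov (masked y r (B v v) (\<lambda>u. \<xi> u \<omega>)) (a v) (a v)) else 0)"
    and integrable_cov_masked: "integrable M (\<lambda>\<omega>. \<xi> v \<omega> * \<xi> w \<omega> * cov (masked y r (B v w) (\<lambda>u. \<xi> u \<omega>)) (a v) (a w))"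
proof -
  let ?F = "\<lambda>x. cov (masked y r (B v w) x) (a v) (a w)"
  have w': "w \<in> V"
    using A_subset v w by auto
  have F: "?F (\<lambda>i\<in>V - B v w. \<xi> i \<omega>) = ?F (\<lambda>u. \<xi> u \<omega>)" for \<omega>
    unfolding cov_def by (intro arg_cong2[where f = "(-)"] arg_cong2[where f = "(*)"] avg_cong masked_restrict)
  have int: "integrable M (\<lambda>\<omega>. ?F (\<lambda>i\<in>V - B v w. \<xi> i \<omega>))"
    unfolding F by (intro integrable_cov v w' measurable_masked_\<xi>)
  have "expectation (\<lambda>\<omega>. ((\<lambda>i\<in>{v, w}. \<xi> i \<omega>) v * (\<lambda>i\<in>{v, w}. \<xi> i \<omega>) w) * ?F (\<lambda>i\<in>V - B v w. \<xi> i \<omega>))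
      = expectation (\<lambda>\<omega>. (\<lambda>i\<in>{v, w}. \<xi> i \<omega>) v * (\<lambda>i\<in>{v, w}. \<xi> i \<omega>) w)
        * expectation (\<lambda>\<omega>. ?F (\<lambda>i\<in>V - B v w. \<xi> i \<omega>))"
    using v w w'
    by (intro indep_subfamilies_expectation_mult[OF prob_space_axioms indep_B, where f = "\<lambda>x. x v * x w"]
        borel_measurable_times measurable_component_singleton measurable_cov measurable_masked int)
      (simp_all add: integrable_mult2)
  then show "expectation (\<lambda>\<omega>. \<xi> v \<omega> * \<xi> w \<omega> * ?F (\<lambda>u. \<xi> u \<omega>))
      = (if v = w then expectation (\<lambda>\<omega>. cov (masked y r (B v v) (\<lambda>u. \<xi> u \<omega>)) (a v) (a v)) else 0)"
    using v w' by (auto simp: F second_moment_\<xi> uncorrelated_\<xi>)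
  show "integrable M (\<lambda>\<omega>. \<xi> v \<omega> * \<xi> w \<omega> * ?F (\<lambda>u. \<xi> u \<omega>))"
  proof (rule Bochner_Integration.integrable_bound)
    show "integrable M (\<lambda>\<omega>. \<xi> v \<omega> * \<xi> w \<omega> * (2 * c * c))"
      by (intro integrable_mult_left integrable_mult2 v w')
    have "\<bar>?F (\<lambda>u. \<xi> u \<omega>)\<bar> \<le> 2 * c * c" for \<omega>
      by (intro abs_cov_le a_bound v w')
    then show "AE \<omega> in M. norm (\<xi> v \<omega> * \<xi> w \<omega> * ?F (\<lambda>u. \<xi> u \<omega>)) \<le> norm (\<xi> v \<omega> * \<xi> w \<omega> * (2 * c * c))"
      using c_nonneg by (auto simp: abs_mult intro!: mult_left_mono)
    show "(\<lambda>\<omega>. \<xi> v \<omega> * \<xi> w \<omega> * ?F (\<lambda>u. \<xi> u \<omega>)) \<in> borel_measurable M"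
      using v w' by (intro borel_measurable_times measurable_cov measurable_masked_\<xi>) auto
  qed
qed

end

section \<open>Integration by parts, exact and approximate\<close>

context gibbs_system
begin

lemma gaussian_integration_by_parts_avg:
  assumes v: "v \<in> V"
  shows "(\<integral>g. g v * avg (\<lambda>u. y u + r * g u) (a v) \<partial>(\<Pi>\<^sub>M v\<in>V. std_normal))
      = r * (\<integral>g. cov (\<lambda>u. y u + r * g u) (a v) (a v) \<partial>(\<Pi>\<^sub>M v\<in>V. std_normal))"
proof -
  let ?X = "\<lambda>g u. y u + r * g u"
  have X: "(\<lambda>g. ?X g u) \<in> borel_measurable (\<Pi>\<^sub>M v\<in>V. std_normal)" if "u \<in> V" for u
    using that by measurable
  have coord: "((\<lambda>t. ?X (g(v := t)) u) has_real_derivative (if u = v then r else 0)) (at x)" for g u x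
    by (auto intro!: derivative_eq_intros)
  \<comment> \<open>Only coordinate \<open>v\<close> moves, at speed \<open>r\<close>, so the sum in
    \<open>DERIV_avg\<close> reduces to one term.\<close>
  have avg': "((\<lambda>t. avg (?X (g(v := t))) h) has_real_derivative
      r * cov (?X (g(v := x))) h (a v)) (at x)" for g h x
  proof -
    have "((\<lambda>t. avg (?X (g(v := t))) h) has_real_derivative
        (\<Sum>u\<in>V. (if u = v then r else 0) * cov (?X (g(v := x))) h (a u))) (at x)"
      by (rule DERIV_avg[where x = "\<lambda>t. ?X (g(v := t))"]) (rule coord)
    then show ?thesis
      using v finite_V by (simp add: if_distrib[of "\<lambda>z. z * _"] sum.delta cong: if_cong)
  qed
  have "(\<integral>g. g v * avg (?X g) (a v) \<partial>(\<Pi>\<^sub>M v\<in>V. std_normal))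
      = (\<integral>g. r * cov (?X g) (a v) (a v) \<partial>(\<Pi>\<^sub>M v\<in>V. std_normal))"
  proof (rule gaussian_integration_by_parts_PiM[OF finite_V v])
    show "((\<lambda>t. avg (?X (g(v := t))) (a v)) has_real_derivative
        r * cov (?X (g(v := x))) (a v) (a v)) (at x)" for g x
      by (rule avg')
    show "isCont (\<lambda>t. r * cov (?X (g(v := t))) (a v) (a v)) x" for g x
      unfolding cov_def by (intro continuous_intros DERIV_isCont[OF avg'])
    show "\<bar>avg (?X g) (a v)\<bar> \<le> c" for g
      using v by (intro abs_avg_le a_bound)
    show "\<bar>r * cov (?X g) (a v) (a v)\<bar> \<le> \<bar>r\<bar> * (2 * c * c)" for g
      unfolding abs_mult using v by (intro mult_left_mono abs_cov_le a_bound) auto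
    show "(\<lambda>g. avg (?X g) (a v)) \<in> borel_measurable (\<Pi>\<^sub>M v\<in>V. std_normal)"
      by (intro measurable_avg X)
    show "(\<lambda>g. r * cov (?X g) (a v) (a v)) \<in> borel_measurable (\<Pi>\<^sub>M v\<in>V. std_normal)"
      by (intro borel_measurable_times measurable_cov X) auto
  qed
  then show ?thesis
    by simp
qed

end

section \<open>The approximate identity for locally dependent couplings\<close>

context dependent_gibbs_system
begin

lemma abs_cov_diff_le:
  assumes "v \<in> V" "w \<in> V" "D \<subseteq> V"
    and "\<And>u. u \<in> V \<Longrightarrow> \<bar>p u - q u\<bar> \<le> (if u \<in> D then \<bar>r\<bar> * \<bar>x u\<bar> else 0)"
  shows "\<bar>cov p (a v) (a w) - cov q (a v) (a w)\<bar> \<le> 6 * c ^ 3 * (\<bar>r\<bar> * (\<Sum>u\<in>D. \<bar>x u\<bar>))"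
proof -
  have "(\<Sum>u\<in>V. \<bar>p u - q u\<bar>) \<le> (\<Sum>u\<in>V. if u \<in> D then \<bar>r\<bar> * \<bar>x u\<bar> else 0)"
    by (intro sum_mono assms)
  also have "\<dots> = \<bar>r\<bar> * (\<Sum>u\<in>D. \<bar>x u\<bar>)"
    using finite_V assms(3) by (simp add: sum.If_cases Int_absorb1 sum_distrib_left)
  finally have "6 * c ^ 3 * (\<Sum>u\<in>V. \<bar>p u - q u\<bar>) \<le> 6 * c ^ 3 * (\<bar>r\<bar> * (\<Sum>u\<in>D. \<bar>x u\<bar>))"
    by (intro mult_left_mono) (use c_nonneg in auto)
  with cov_lipschitz[OF assms(1,2)] show ?thesis
    by (rule order.trans)
qed

text \<open>A pointwise estimate without probability. The mean value theorem produces covariances at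
  an intermediate point, with one term for each \<open>w\<close> in \<open>A v\<close>; moving that
  point to the vector frozen on \<open>B v w\<close> costs one third derivative for each
  \<open>u\<close> in \<open>B v w\<close>.\<close>

lemma abs_avg_remainder_le:
  assumes v: "v \<in> V"
  shows "\<bar>x v * (avg (masked y r {} x) (a v) - avg (masked y r (A v) x) (a v))
      - (\<Sum>w\<in>A v. r * (x v * x w * cov (masked y r (B v w) x) (a v) (a w)))\<bar>
    \<le> 6 * c ^ 3 * r\<^sup>2 * (\<Sum>w\<in>A v. \<Sum>u\<in>B v w. \<bar>x v * x w * x u\<bar>)"
proof -
  let ?X = "masked y r {} x" and ?Xm = "masked y r (A v) x"
  have A: "A v \<subseteq> V"
    using A_subset[OF v] .
  obtain t where t: "0 < t" "t < 1" and mvt: "avg ?X (a v) - avg ?Xm (a v)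
      = (\<Sum>u\<in>V. (?X u - ?Xm u) * cov (\<lambda>u. ?Xm u + t * (?X u - ?Xm u)) (a v) (a u))"
    using avg_mvt[of ?X "a v" ?Xm] by blast
  define p where "p u = ?Xm u + t * (?X u - ?Xm u)" for u
  have X_diff: "?X u - ?Xm u = (if u \<in> A v then r * x u else 0)" for u
    unfolding masked_def by (cases "u \<in> A v") simp_all
  have "(\<Sum>u\<in>V. (?X u - ?Xm u) * cov p (a v) (a u))
      = (\<Sum>u\<in>V. if u \<in> A v then r * x u * cov p (a v) (a u) else 0)"
    by (intro sum.cong refl) (simp add: X_diff)
  also have "\<dots> = (\<Sum>u\<in>A v. r * x u * cov p (a v) (a u))"
    using finite_V A by (simp add: sum.If_cases Int_absorb1)
  finally have "avg ?X (a v) - avg ?Xm (a v) = (\<Sum>w\<in>A v. r * x w * cov p (a v) (a w))"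
    unfolding mvt p_def[abs_def] .
  then have "x v * (avg ?X (a v) - avg ?Xm (a v))
      - (\<Sum>w\<in>A v. r * (x v * x w * cov (masked y r (B v w) x) (a v) (a w)))
      = (\<Sum>w\<in>A v. r * (x v * x w) * (cov p (a v) (a w) - cov (masked y r (B v w) x) (a v) (a w)))"
    by (simp add: sum_distrib_left sum_subtractf[symmetric] algebra_simps)
  moreover have "\<bar>r * (x v * x w) * (cov p (a v) (a w) - cov (masked y r (B v w) x) (a v) (a w))\<bar>
      \<le> 6 * c ^ 3 * r\<^sup>2 * (\<Sum>u\<in>B v w. \<bar>x v * x w * x u\<bar>)" if w: "w \<in> A v" for w
  proof -
    have "\<bar>cov p (a v) (a w) - cov (masked y r (B v w) x) (a v) (a w)\<bar>
        \<le> 6 * c ^ 3 * (\<bar>r\<bar> * (\<Sum>u\<in>B v w. \<bar>x u\<bar>))"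
    proof (rule abs_cov_diff_le[OF v _ B_subset[OF v w]])
      have "\<bar>t * (r * x u)\<bar> \<le> \<bar>r\<bar> * \<bar>x u\<bar>" for u
        using t by (simp add: abs_mult mult_left_le_one_le)
      then show "\<bar>p u - masked y r (B v w) x u\<bar> \<le> (if u \<in> B v w then \<bar>r\<bar> * \<bar>x u\<bar> else 0)" for u
        using A_subset_B[OF v w] by (auto simp: p_def masked_def abs_mult)
    qed (use A w in auto)
    then have "\<bar>r * (x v * x w)\<bar> * \<bar>cov p (a v) (a w) - cov (masked y r (B v w) x) (a v) (a w)\<bar>
        \<le> \<bar>r * (x v * x w)\<bar> * (6 * c ^ 3 * (\<bar>r\<bar> * (\<Sum>u\<in>B v w. \<bar>x u\<bar>)))"
      by (intro mult_left_mono) auto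
    also have "\<dots> = 6 * c ^ 3 * \<bar>r\<bar>\<^sup>2 * (\<Sum>u\<in>B v w. \<bar>x v * x w * x u\<bar>)"
      by (simp add: abs_mult sum_distrib_left power2_eq_square mult_ac del: abs_mult_self_eq)
    finally show ?thesis
      by (simp add: abs_mult)
  qed
  ultimately show ?thesis
    by (simp only: sum_distrib_left[of "6 * c ^ 3 * r\<^sup>2"])
      (intro order.trans[OF sum_abs] sum_mono)
qed

text \<open>Freezing \<open>B v v\<close> costs a sum over \<open>B v v\<close>. This is the summand
  \<open>w = v\<close> of the stated bound, which is enlarged to the same index range as in
  \<open>abs_avg_remainder_le\<close>.\<close>

lemma abs_cov_remainder_le:
  assumes v: "v \<in> V"
  shows "\<bar>r * cov (masked y r {} x) (a v) (a v) - r * cov (masked y r (B v v) x) (a v) (a v)\<bar>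
    \<le> 6 * c ^ 3 * r\<^sup>2 * (\<Sum>w\<in>A v. \<Sum>u\<in>B v w. \<bar>x u\<bar>)"
proof -
  note vA = self_mem_A[OF v]
  have "\<bar>r\<bar> * \<bar>cov (masked y r {} x) (a v) (a v) - cov (masked y r (B v v) x) (a v) (a v)\<bar>
      \<le> \<bar>r\<bar> * (6 * c ^ 3 * (\<bar>r\<bar> * (\<Sum>u\<in>B v v. \<bar>x u\<bar>)))"
    by (intro mult_left_mono abs_cov_diff_le v B_subset[OF v vA]) (auto simp: masked_def abs_mult)
  also have "\<dots> = 6 * c ^ 3 * r\<^sup>2 * (\<Sum>u\<in>B v v. \<bar>x u\<bar>)"
    by (simp add: power2_eq_square mult_ac flip: abs_mult)
  also have "\<dots> \<le> 6 * c ^ 3 * r\<^sup>2 * (\<Sum>w\<in>A v. \<Sum>u\<in>B v w. \<bar>x u\<bar>)"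
    using vA finite_subset[OF A_subset[OF v] finite_V] c_nonneg
    by (intro mult_left_mono member_le_sum) (auto intro!: sum_nonneg)
  finally show ?thesis
    by (simp add: abs_mult flip: right_diff_distrib)
qed

lemma integrable_\<xi>_avg:
  assumes v: "v \<in> V" and X: "\<And>u. u \<in> V \<Longrightarrow> (\<lambda>\<omega>. X \<omega> u) \<in> borel_measurable M"
  shows "integrable M (\<lambda>\<omega>. \<xi> v \<omega> * avg (X \<omega>) (a v))"
proof (rule Bochner_Integration.integrable_bound)
  show "integrable M (\<lambda>\<omega>. \<xi> v \<omega> * c)"
    using v by (intro integrable_mult_left integrable_\<xi>)
  have "\<bar>avg (X \<omega>) (a v)\<bar> \<le> c" for \<omega>
    using v by (intro abs_avg_le a_bound)
  then show "AE \<omega> in M. norm (\<xi> v \<omega> * avg (X \<omega>) (a v)) \<le> norm (\<xi> v \<omega> * c)"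
    using c_nonneg by (auto simp: abs_mult intro!: mult_left_mono)
  show "(\<lambda>\<omega>. \<xi> v \<omega> * avg (X \<omega>) (a v)) \<in> borel_measurable M"
    using v X by (intro borel_measurable_times measurable_avg) auto
qed

text \<open>Subtracting a frozen comparison variable of mean zero leaves just the two pointwise
  remainders. In the factor \<open>K + 1\<close>, \<open>K\<close> pays for triple products and 1
  for the single factors \<open>\<bar>\<xi> u \<omega>\<bar>\<close>.\<close>

lemma approximate_integration_by_parts_single:
  assumes v: "v \<in> V"
  shows "\<bar>expectation (\<lambda>\<omega>. \<xi> v \<omega> * avg (\<lambda>u. y u + r * \<xi> u \<omega>) (a v)
      - r * cov (\<lambda>u. y u + r * \<xi> u \<omega>) (a v) (a v))\<bar>
    \<le> r\<^sup>2 * (6 * c ^ 3 * (K + 1) * (\<Sum>w\<in>A v. real (card (B v w))))"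
proof -
  let ?X = "\<lambda>D \<omega>. masked y r D (\<lambda>u. \<xi> u \<omega>)"
  let ?Y = "\<lambda>\<omega>. \<xi> v \<omega> * avg (?X {} \<omega>) (a v) - r * cov (?X {} \<omega>) (a v) (a v)"
  let ?Ym = "\<lambda>\<omega>. \<xi> v \<omega> * avg (?X (A v) \<omega>) (a v)
    + (\<Sum>w\<in>A v. r * (\<xi> v \<omega> * \<xi> w \<omega> * cov (?X (B v w) \<omega>) (a v) (a w)))
    - r * cov (?X (B v v) \<omega>) (a v) (a v)"
  let ?R = "\<lambda>\<omega>. 6 * c ^ 3 * r\<^sup>2 * (\<Sum>w\<in>A v. \<Sum>u\<in>B v w. \<bar>\<xi> v \<omega> * \<xi> w \<omega> * \<xi> u \<omega>\<bar> + \<bar>\<xi> u \<omega>\<bar>)"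
  note vA = self_mem_A[OF v]
  have AV: "w \<in> V" if "w \<in> A v" for w
    using A_subset[OF v] that by auto
  have BV: "u \<in> V" if "w \<in> A v" "u \<in> B v w" for u w
    using B_subset[OF v that(1)] that by auto
  have fin: "finite (A v)"
    using A_subset[OF v] finite_V by (rule finite_subset)
  have Y: "integrable M ?Y"
    by (intro Bochner_Integration.integrable_diff integrable_mult_right integrable_\<xi>_avg integrable_cov
        measurable_masked_\<xi> v)
  have Y0_parts: "integrable M (\<lambda>\<omega>. \<xi> v \<omega> * avg (?X (A v) \<omega>) (a v))"
    "\<And>w. w \<in> A v \<Longrightarrow> integrable M (\<lambda>\<omega>. \<xi> v \<omega> * \<xi> w \<omega> * cov (?X (B v w) \<omega>) (a v) (a w))"
    "integrable M (\<lambda>\<omega>. cov (?X (B v v) \<omega>) (a v) (a v))"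
    by (intro integrable_\<xi>_avg integrable_cov integrable_cov_masked measurable_masked_\<xi> v; assumption)+
  have sum_part: "integrable M (\<lambda>\<omega>. \<Sum>w\<in>A v. r * (\<xi> v \<omega> * \<xi> w \<omega> * cov (?X (B v w) \<omega>) (a v) (a w)))"
    by (rule Bochner_Integration.integrable_sum[OF integrable_mult_right[OF Y0_parts(2)]])
  note add_part = Bochner_Integration.integrable_add[OF Y0_parts(1) sum_part]
  have Y0: "integrable M ?Ym"
    by (rule Bochner_Integration.integrable_diff[OF add_part integrable_mult_right[OF Y0_parts(3)]])
  have "expectation ?Ym = (\<Sum>w\<in>A v. r * (if v = w then expectation (\<lambda>\<omega>. cov (?X (B v v) \<omega>) (a v) (a v)) else 0))
      - r * expectation (\<lambda>\<omega>. cov (?X (B v v) \<omega>) (a v) (a v))"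
    using Y0_parts sum_part add_part v by (simp add: expectation_avg_masked expectation_cov_masked)
  \<comment> \<open>The surviving summand \<open>w = v\<close>, present because \<open>v\<close>
    belongs to \<open>A v\<close>, cancels the last term.\<close>
  also have "\<dots> = 0"
    using vA fin by (simp add: if_distrib[of "\<lambda>z. r * z"] sum.delta cong: if_cong)
  finally have Y_eq: "expectation ?Y = expectation (\<lambda>\<omega>. ?Y \<omega> - ?Ym \<omega>)"
    using Y Y0 by simp
  have le: "\<bar>?Y \<omega> - ?Ym \<omega>\<bar> \<le> ?R \<omega>" for \<omega>
  proof -
    \<comment> \<open>Here \<open>d1 - s\<close> is the remainder of the average and
      \<open>d2 - d3\<close> the freezing error of the covariance.\<close>
    have "\<bar>d1 - s - (d2 - d3)\<bar> \<le> e1 + e2" if "\<bar>d1 - s\<bar> \<le> e1" "\<bar>d2 - d3\<bar> \<le> e2" for d1 d2 d3 s e1 e2 :: real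
      using that by linarith
    from this[OF abs_avg_remainder_le[OF v, of "\<lambda>u. \<xi> u \<omega>" y r] abs_cov_remainder_le[OF v, of r y "\<lambda>u. \<xi> u \<omega>"]]
    show ?thesis
      by (simp only: sum.distrib distrib_left right_diff_distrib)
  qed
  have R: "integrable M ?R"
    using v AV BV by (intro integrable_mult_right Bochner_Integration.integrable_sum
        Bochner_Integration.integrable_add expectation_abs_mult3 integrable_abs integrable_\<xi>) auto
  have "\<bar>expectation ?Y\<bar> \<le> expectation (\<lambda>\<omega>. \<bar>?Y \<omega> - ?Ym \<omega>\<bar>)"
    unfolding Y_eq by (rule integral_abs_bound)
  also have "\<dots> \<le> expectation ?R"
    by (intro integral_mono integrable_abs Bochner_Integration.integrable_diff Y Y0 R le)
  also have "\<dots> = 6 * c ^ 3 * r\<^sup>2 * (\<Sum>w\<in>A v. \<Sum>u\<in>B v w.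
      expectation (\<lambda>\<omega>. \<bar>\<xi> v \<omega> * \<xi> w \<omega> * \<xi> u \<omega>\<bar>) + expectation (\<lambda>\<omega>. \<bar>\<xi> u \<omega>\<bar>))"
    using v AV BV expectation_abs_mult3(1) integrable_\<xi> by simp
  also have "\<dots> \<le> 6 * c ^ 3 * r\<^sup>2 * (\<Sum>w\<in>A v. \<Sum>u\<in>B v w. K + 1)"
    using v AV BV c_nonneg
    by (intro mult_left_mono sum_mono add_mono expectation_abs_mult3 expectation_abs_le_1) auto
  also have "\<dots> = r\<^sup>2 * (6 * c ^ 3 * (K + 1) * (\<Sum>w\<in>A v. real (card (B v w))))"
    by (simp add: sum_distrib_left sum_distrib_right mult_ac)
  finally show ?thesis
    by (simp add: masked_def)
qed

text \<open>For \<open>c\<close> of order \<open>N^(-1/2)\<close> and the double sum at most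
  \<open>N^2 * \<eta>\<close>, this is of order \<open>sqrt N * \<eta>\<close>.\<close>

definition error_bound :: real where
  "error_bound = 6 * c ^ 3 * (K + 1) * (\<Sum>v\<in>V. \<Sum>w\<in>A v. real (card (B v w)))"

text \<open>The bound is uniform in the deterministic shift \<open>y\<close>, so a Gaussian
  configuration can be held fixed here and integrated out afterwards.\<close>

lemma approximate_integration_by_parts:
  "\<bar>expectation (\<lambda>\<omega>. \<Sum>v\<in>V. \<xi> v \<omega> * avg (\<lambda>u. y u + r * \<xi> u \<omega>) (a v)
      - r * cov (\<lambda>u. y u + r * \<xi> u \<omega>) (a v) (a v))\<bar> \<le> r\<^sup>2 * error_bound"
proof -
  let ?Y = "\<lambda>v \<omega>. \<xi> v \<omega> * avg (\<lambda>u. y u + r * \<xi> u \<omega>) (a v) - r * cov (\<lambda>u. y u + r * \<xi> u \<omega>) (a v) (a v)"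
  have "integrable M (?Y v)" if "v \<in> V" for v
    by (intro Bochner_Integration.integrable_diff integrable_mult_right integrable_\<xi>_avg integrable_cov that)
      measurable
  then have "\<bar>expectation (\<lambda>\<omega>. \<Sum>v\<in>V. ?Y v \<omega>)\<bar> = \<bar>\<Sum>v\<in>V. expectation (?Y v)\<bar>"
    by simp
  also have "\<dots> \<le> (\<Sum>v\<in>V. r\<^sup>2 * (6 * c ^ 3 * (K + 1) * (\<Sum>w\<in>A v. real (card (B v w)))))"
    by (intro order.trans[OF sum_abs] sum_mono approximate_integration_by_parts_single)
  finally show ?thesis
    by (simp add: error_bound_def sum_distrib_left)
qed

end

section \<open>Interpolation\<close>

lemma distr_pair_snd:
  assumes "prob_space M" "sigma_finite_measure N"
  shows "distr (M \<Otimes>\<^sub>M N) N snd = N"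
proof (intro measure_eqI)
  interpret M: prob_space M by fact
  interpret N: sigma_finite_measure N by fact
  fix A assume A: "A \<in> sets (distr (M \<Otimes>\<^sub>M N) N snd)"
  from A have "emeasure (distr (M \<Otimes>\<^sub>M N) N snd) A = emeasure (M \<Otimes>\<^sub>M N) (space M \<times> A)"
    by (auto simp add: emeasure_distr space_pair_measure dest: sets.sets_into_space
        intro!: arg_cong2[where f=emeasure])
  with A show "emeasure (distr (M \<Otimes>\<^sub>M N) N snd) A = emeasure N A"
    by (simp add: N.emeasure_pair_measure_Times M.emeasure_space_1)
qed simp

section \<open>The product space and the rotation path\<close>

context dependent_gibbs_system
begin

abbreviation G :: "('v \<Rightarrow> real) measure" where
  "G \<equiv> \<Pi>\<^sub>M v\<in>V. std_normal"

abbreviation P :: "('a \<times> ('v \<Rightarrow> real)) measure" where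
  "P \<equiv> M \<Otimes>\<^sub>M G"

lemma prob_space_G: "prob_space G"
  by (intro prob_space_PiM prob_space_std_normal)

sublocale G: prob_space G
  by (rule prob_space_G)

sublocale MG: pair_prob_space M G ..

lemma integrable_fst_P: "integrable M f \<Longrightarrow> integrable P (\<lambda>p. f (fst p))" for f :: "'a \<Rightarrow> real"
  using integrable_distr[of fst P M f] G.distr_pair_fst[of M] by simp

lemma integrable_snd_P: "integrable G f \<Longrightarrow> integrable P (\<lambda>p. f (snd p))" for f :: "('v \<Rightarrow> real) \<Rightarrow> real"
  using integrable_distr[of snd P G f] distr_pair_snd[OF prob_space_axioms, of G] by (simp add: G.sigma_finite_measure_axioms)

lemma measurable_fst_P [measurable]: "v \<in> V \<Longrightarrow> (\<lambda>p. \<xi> v (fst p)) \<in> borel_measurable P"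
  by measurable

lemma measurable_snd_P [measurable]: "v \<in> V \<Longrightarrow> (\<lambda>p. snd p v) \<in> borel_measurable P"
  using measurable_compose[OF measurable_snd measurable_component_singleton[of v V "\<lambda>_. std_normal"]]
  by (simp cong: measurable_cong_sets)

text \<open>As the squares of \<open>sin t\<close> and \<open>cos t\<close> add up to 1, covariances
  stay constant along the path. Unlike square-root weights, these are differentiable at both
  endpoints as well.\<close>

definition rotation :: "real \<Rightarrow> 'a \<times> ('v \<Rightarrow> real) \<Rightarrow> 'v \<Rightarrow> real" where
  "rotation t p v = sin t * \<xi> v (fst p) + cos t * snd p v"

definition velocity :: "real \<Rightarrow> 'a \<times> ('v \<Rightarrow> real) \<Rightarrow> 'v \<Rightarrow> real" where
  "velocity t p v = cos t * \<xi> v (fst p) - sin t * snd p v"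

lemma measurable_rotation [measurable]: "v \<in> V \<Longrightarrow> (\<lambda>p. rotation t p v) \<in> borel_measurable P"
  and measurable_velocity [measurable]: "v \<in> V \<Longrightarrow> (\<lambda>p. velocity t p v) \<in> borel_measurable P"
  unfolding rotation_def velocity_def by measurable

text \<open>One integrable function, independent of \<open>t\<close>, controls both the deviation of
  \<open>ln Z\<close> from its value at zero couplings and the derivative along the path.\<close>

definition dominant :: "'a \<times> ('v \<Rightarrow> real) \<Rightarrow> real" where
  "dominant p = c * (\<Sum>v\<in>V. \<bar>\<xi> v (fst p)\<bar> + \<bar>snd p v\<bar>)"

lemma integrable_dominant: "integrable P dominant"
  unfolding dominant_def[abs_def]
  by (intro integrable_mult_right Bochner_Integration.integrable_sum Bochner_Integration.integrable_add
      integrable_abs integrable_fst_P integrable_snd_P[where f = "\<lambda>g. g _"]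
      integrable_\<xi> integrable_std_normal_component)

lemma abs_sin_cos_mult_le: "\<bar>sin t * x\<bar> \<le> \<bar>x\<bar>" "\<bar>cos t * x\<bar> \<le> \<bar>x\<bar>" for t x :: real
  by (simp_all add: abs_mult mult_left_le_one_le)

lemma abs_rotation_le: "\<bar>rotation t p v\<bar> \<le> \<bar>\<xi> v (fst p)\<bar> + \<bar>snd p v\<bar>"
  and abs_velocity_le: "\<bar>velocity t p v\<bar> \<le> \<bar>\<xi> v (fst p)\<bar> + \<bar>snd p v\<bar>"
  using abs_sin_cos_mult_le[of t "\<xi> v (fst p)"] abs_sin_cos_mult_le[of t "snd p v"]
  unfolding rotation_def velocity_def by linarith+

lemma integrable_ln_Z_rotation: "integrable P (\<lambda>p. ln (Z (rotation t p)))"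
proof (rule Bochner_Integration.integrable_bound)
  show "integrable P (\<lambda>p. \<bar>ln (Z (\<lambda>_. 0))\<bar> + dominant p)"
    by (intro Bochner_Integration.integrable_add integrable_dominant) simp
  have "\<bar>ln (Z (rotation t p))\<bar> \<le> \<bar>ln (Z (\<lambda>_. 0))\<bar> + dominant p" for p
  proof -
    have "\<bar>ln (Z (rotation t p)) - ln (Z (\<lambda>_. 0))\<bar> \<le> c * (\<Sum>v\<in>V. \<bar>rotation t p v - 0\<bar>)"
      by (rule ln_Z_lipschitz)
    also have "\<dots> \<le> dominant p"
      unfolding dominant_def using abs_rotation_le c_nonneg by (intro mult_left_mono sum_mono) auto
    finally show ?thesis
      by linarith
  qed
  then show "AE p in P. norm (ln (Z (rotation t p))) \<le> norm (\<bar>ln (Z (\<lambda>_. 0))\<bar> + dominant p)"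
    unfolding real_norm_def by (intro AE_I2 order.trans[OF _ abs_ge_self])
  show "(\<lambda>p. ln (Z (rotation t p))) \<in> borel_measurable P"
    by (intro borel_measurable_ln measurable_Z measurable_rotation)
qed

section \<open>The interpolated expectation and its derivative\<close>

definition interpolation :: "real \<Rightarrow> real" where
  "interpolation t = (\<integral>p. ln (Z (rotation t p)) \<partial>P)"

definition interpolation' :: "real \<Rightarrow> real" where
  "interpolation' t = (\<integral>p. (\<Sum>v\<in>V. velocity t p v * avg (rotation t p) (a v)) \<partial>P)"

lemma DERIV_interpolation: "(interpolation has_real_derivative interpolation' t) (at t)"
  unfolding interpolation_def[abs_def] interpolation'_def
proof (rule has_real_derivative_integral[OF integrable_ln_Z_rotation _ _ _ integrable_dominant])
  show "(\<lambda>p. \<Sum>v\<in>V. velocity t p v * avg (rotation t p) (a v)) \<in> borel_measurable P" for t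
    by (intro borel_measurable_sum borel_measurable_times measurable_avg measurable_rotation measurable_velocity)
  have "((\<lambda>t. rotation t p v) has_real_derivative velocity t p v) (at t)" for t p v
    unfolding rotation_def velocity_def by (auto intro!: derivative_eq_intros)
  then show "((\<lambda>t. ln (Z (rotation t p))) has_real_derivative
      (\<Sum>v\<in>V. velocity t p v * avg (rotation t p) (a v))) (at t)" for t p
    by (intro DERIV_ln_Z)
  show "\<bar>\<Sum>v\<in>V. velocity t p v * avg (rotation t p) (a v)\<bar> \<le> dominant p" for t p
    unfolding dominant_def sum_distrib_left mult.commute[of c]
    by (intro order.trans[OF sum_abs] sum_mono)
      (auto simp: abs_mult intro!: mult_mono abs_velocity_le abs_avg_le a_bound)
qed

lemma integrable_mult_avg_rotation:
  assumes v: "v \<in> V" and f: "integrable P f"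
  shows "integrable P (\<lambda>p. f p * avg (rotation t p) (a v))"
proof (rule Bochner_Integration.integrable_bound)
  show "integrable P (\<lambda>p. f p * c)"
    by (intro integrable_mult_left f)
  have "\<bar>avg (rotation t p) (a v)\<bar> \<le> c" for p
    using v by (intro abs_avg_le a_bound)
  then show "AE p in P. norm (f p * avg (rotation t p) (a v)) \<le> norm (f p * c)"
    using c_nonneg by (auto simp: abs_mult intro!: mult_left_mono)
  show "(\<lambda>p. f p * avg (rotation t p) (a v)) \<in> borel_measurable P"
    using f by (intro borel_measurable_times measurable_avg measurable_rotation) auto
qed

lemma integrable_cov_rotation:
  assumes "v \<in> V"
  shows "integrable P (\<lambda>p. cov (rotation t p) (a v) (a v))"
  using assms
  by (intro MG.P.integrable_const_bound[where B = "2 * c * c"] AE_I2 measurable_cov measurable_rotation)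
    (auto intro!: abs_cov_le a_bound)

text \<open>For fixed \<open>\<omega>\<close> the inner integral over \<open>g\<close> is exact
  Gaussian integration by parts with shift \<open>sin t * \<xi> u \<omega>\<close> and scale
  \<open>cos t\<close>.\<close>

lemma gaussian_part:
  assumes v: "v \<in> V"
  shows "(\<integral>p. snd p v * avg (rotation t p) (a v) \<partial>P) = cos t * (\<integral>p. cov (rotation t p) (a v) (a v) \<partial>P)"
proof -
  have "integrable P (\<lambda>p. snd p v * avg (rotation t p) (a v))"
    by (intro integrable_mult_avg_rotation v integrable_snd_P[where f = "\<lambda>g. g _"] integrable_std_normal_component)
  then have "(\<integral>p. snd p v * avg (rotation t p) (a v) \<partial>P) = (\<integral>\<omega>. \<integral>g. g v * avg (rotation t (\<omega>, g)) (a v) \<partial>G \<partial>M)"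
    by (subst MG.integral_fst'[symmetric]) simp_all
  also have "\<dots> = (\<integral>\<omega>. cos t * (\<integral>g. cov (rotation t (\<omega>, g)) (a v) (a v) \<partial>G) \<partial>M)"
    using gaussian_integration_by_parts_avg[OF v]
    by (simp add: rotation_def[abs_def])
  also have "\<dots> = cos t * (\<integral>p. cov (rotation t p) (a v) (a v) \<partial>P)"
    using MG.integral_fst'[OF integrable_cov_rotation[OF v]] by simp
  finally show ?thesis .
qed

lemma abs_interpolation'_le:
  "\<bar>interpolation' t\<bar> \<le> error_bound"
proof -
  let ?f = "\<lambda>p. \<Sum>v\<in>V. \<xi> v (fst p) * avg (rotation t p) (a v) - sin t * cov (rotation t p) (a v) (a v)"
  have int: "integrable P (\<lambda>p. \<xi> v (fst p) * avg (rotation t p) (a v))"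
    "integrable P (\<lambda>p. snd p v * avg (rotation t p) (a v))" if "v \<in> V" for v
    using that by (intro integrable_mult_avg_rotation integrable_fst_P integrable_snd_P[where f = "\<lambda>g. g _"]
        integrable_std_normal_component integrable_\<xi>; assumption)+
  have f: "integrable P ?f"
    by (intro Bochner_Integration.integrable_sum Bochner_Integration.integrable_diff
        integrable_mult_right int integrable_cov_rotation)
  have "interpolation' t = (\<Sum>v\<in>V. cos t * (\<integral>p. \<xi> v (fst p) * avg (rotation t p) (a v) \<partial>P)
      - sin t * (\<integral>p. snd p v * avg (rotation t p) (a v) \<partial>P))"
    unfolding interpolation'_def velocity_def by (simp add: int left_diff_distrib mult.assoc)
  \<comment> \<open>The Gaussian term equals \<open>sin t * cos t\<close> times the expected
    covariance; extracting \<open>cos t\<close> leaves the defect in integration by parts for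
    \<open>\<xi>\<close>.\<close>
  also have "\<dots> = cos t * (\<integral>p. ?f p \<partial>P)"
    by (simp add: int integrable_cov_rotation gaussian_part sum_distrib_left right_diff_distrib mult_ac)
  \<comment> \<open>Fubini in the opposite order: \<open>g\<close> is held fixed, so the approximate
    identity applies with \<open>y = cos t * g\<close> and \<open>r = sin t\<close>.\<close>
  also have "(\<integral>p. ?f p \<partial>P) = (\<integral>g. \<integral>\<omega>. ?f (\<omega>, g) \<partial>M \<partial>G)"
    using MG.integral_snd[of "\<lambda>\<omega> g. ?f (\<omega>, g)"] f by (simp add: case_prod_unfold)
  finally have "\<bar>interpolation' t\<bar> \<le> \<bar>\<integral>g. \<integral>\<omega>. ?f (\<omega>, g) \<partial>M \<partial>G\<bar>"
    using abs_sin_cos_mult_le by simp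
  also have "\<dots> \<le> (\<integral>g. error_bound \<partial>G)"
  proof (rule order.trans[OF integral_abs_bound], rule integral_mono)
    show "integrable G (\<lambda>g. \<bar>\<integral>\<omega>. ?f (\<omega>, g) \<partial>M\<bar>)"
      using MG.integrable_snd[of "\<lambda>\<omega> g. ?f (\<omega>, g)"] f by (intro integrable_abs) (simp add: case_prod_unfold)
    show "\<bar>\<integral>\<omega>. ?f (\<omega>, g) \<partial>M\<bar> \<le> error_bound" for g
    proof -
      have "rotation t (\<omega>, g) = (\<lambda>u. cos t * g u + sin t * \<xi> u \<omega>)" for \<omega>
        by (auto simp: rotation_def)
      then have *: "\<bar>\<integral>\<omega>. ?f (\<omega>, g) \<partial>M\<bar> \<le> (sin t)\<^sup>2 * error_bound"
        using approximate_integration_by_parts[of "\<lambda>u. cos t * g u" "sin t"] by simp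
      also have "\<dots> \<le> error_bound"
      proof -
        \<comment> \<open>Nonnegativity is read off from the case \<open>r = 1\<close>, where
          \<open>error_bound\<close> dominates an absolute value.\<close>
        have "error_bound \<ge> 0"
          using order.trans[OF abs_ge_zero approximate_integration_by_parts[of "\<lambda>_. 0" 1]] by simp
        then show ?thesis
          by (intro mult_left_le_one_le) (auto simp: abs_square_le_1)
      qed
      finally show ?thesis .
    qed
  qed simp
  finally show ?thesis
    by (simp add: G.prob_space)
qed

text \<open>The endpoints 0 and \<open>pi / 2\<close> give the Gaussian and the dependent model. The
  mean value theorem gives the factor \<open>pi / 2\<close>, rounded up to 2.\<close>

lemma abs_ln_Z_gaussian_diff_le:
  "\<bar>expectation (\<lambda>\<omega>. ln (Z (\<lambda>v. \<xi> v \<omega>))) - (\<integral>g. ln (Z g) \<partial>G)\<bar> \<le> 2 * error_bound"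
proof -
  have meas_Z: "(\<lambda>\<omega>. ln (Z (\<lambda>v. \<xi> v \<omega>))) \<in> borel_measurable M" "(\<lambda>g. ln (Z g)) \<in> borel_measurable G"
    by (intro borel_measurable_ln measurable_Z; measurable)+
  have "interpolation (pi / 2) = (\<integral>p. ln (Z (\<lambda>v. \<xi> v (fst p))) \<partial>P)"
    by (simp add: interpolation_def rotation_def[abs_def])
  also have "\<dots> = expectation (\<lambda>\<omega>. ln (Z (\<lambda>v. \<xi> v \<omega>)))"
    using integral_distr[OF measurable_fst meas_Z(1), of G] G.distr_pair_fst[of M] by simp
  finally have 1: "interpolation (pi / 2) = expectation (\<lambda>\<omega>. ln (Z (\<lambda>v. \<xi> v \<omega>)))" .
  have "interpolation 0 = (\<integral>p. ln (Z (snd p)) \<partial>P)"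
    by (simp add: interpolation_def rotation_def[abs_def])
  also have "\<dots> = (\<integral>g. ln (Z g) \<partial>G)"
    using integral_distr[OF measurable_snd meas_Z(2), of M]
      distr_pair_snd[OF prob_space_axioms G.sigma_finite_measure_axioms] by simp
  finally have 0: "interpolation 0 = (\<integral>g. ln (Z g) \<partial>G)" .
  obtain t where "interpolation (pi / 2) - interpolation 0 = (pi / 2 - 0) * interpolation' t"
    using MVT2[of 0 "pi / 2" interpolation interpolation'] DERIV_interpolation by auto
  then have "\<bar>interpolation (pi / 2) - interpolation 0\<bar> = \<bar>(pi / 2 - 0) * interpolation' t\<bar>"
    by (simp only:)
  also have "\<dots> = pi / 2 * \<bar>interpolation' t\<bar>"
    by (simp add: abs_mult)
  also have "\<dots> \<le> 2 * error_bound"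
    using pi_less_4 by (intro mult_mono abs_interpolation'_le) auto
  finally show ?thesis
    unfolding 0 1 .
qed

end

section \<open>The Sherrington--Kirkpatrick model\<close>

lemma finite_sk_pairs: "finite (sk_pairs N)" and card_sk_pairs_le: "card (sk_pairs N) \<le> N ^ 2"
proof -
  have sub: "sk_pairs N \<subseteq> {1..N} \<times> {1..N}"
    by (auto simp: sk_pairs_def)
  show "finite (sk_pairs N)"
    using sub by (rule finite_subset) simp
  show "card (sk_pairs N) \<le> N ^ 2"
    using card_mono[OF _ sub] by (simp add: power2_eq_square)
qed

lemma sk_spins_finite: "finite (sk_spins N)" and sk_spins_nonempty: "sk_spins N \<noteq> {}"
  by (auto simp: sk_spins_def finite_PiE PiE_eq_empty_iff)

text \<open>Finiteness of \<open>V\<close> makes the set of sums bounded, which a supremum of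
  natural numbers requires in order to be an upper bound.\<close>

lemma sum_card_le_dependence_size:
  assumes "finite V" "v \<in> V"
  shows "(\<Sum>w\<in>A v. card (B v w)) \<le> dependence_size V A B"
  unfolding dependence_size_def using assms by (intro cSUP_upper) auto

theorem theorem4p2:
  fixes \<beta> \<tau> :: real
    and M :: "nat \<Rightarrow> 'a measure"
    and \<xi> :: "nat \<Rightarrow> nat \<times> nat \<Rightarrow> 'a \<Rightarrow> real"
    and A :: "nat \<Rightarrow> nat \<times> nat \<Rightarrow> (nat \<times> nat) set"
    and B :: "nat \<Rightarrow> nat \<times> nat \<Rightarrow> nat \<times> nat \<Rightarrow> (nat \<times> nat) set"
  assumes beta_pos: "\<beta> > 0"
    and gaussian_limit_exists: "convergent (sk_gauss_free_energy \<beta>)"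
    and prob: "\<And>N. N \<ge> 2 \<Longrightarrow> prob_space (M N)"
    and rv: "\<And>N v. N \<ge> 2 \<Longrightarrow> v \<in> sk_pairs N \<Longrightarrow> \<xi> N v \<in> borel_measurable (M N)"
    and integrable: "\<And>N v. N \<ge> 2 \<Longrightarrow> v \<in> sk_pairs N \<Longrightarrow> integrable (M N) (\<xi> N v)"
    and mean: "\<And>N v. N \<ge> 2 \<Longrightarrow> v \<in> sk_pairs N \<Longrightarrow> prob_space.expectation (M N) (\<xi> N v) = 0"
    and var: "\<And>N v. N \<ge> 2 \<Longrightarrow> v \<in> sk_pairs N \<Longrightarrow> prob_space.variance (M N) (\<xi> N v) = 1"
    and third_integrable: "\<And>N v. N \<ge> 2 \<Longrightarrow> v \<in> sk_pairs N \<Longrightarrow>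
           integrable (M N) (\<lambda>\<omega>. \<bar>\<xi> N v \<omega>\<bar> ^ 3)"
    and third_moment: "\<And>N v. N \<ge> 2 \<Longrightarrow> v \<in> sk_pairs N \<Longrightarrow>
           prob_space.expectation (M N) (\<lambda>\<omega>. \<bar>\<xi> N v \<omega>\<bar> ^ 3) \<le> \<tau> ^ 3"
    and uncorrelated: "\<And>N v w. N \<ge> 2 \<Longrightarrow> v \<in> sk_pairs N \<Longrightarrow> w \<in> sk_pairs N \<Longrightarrow> v \<noteq> w \<Longrightarrow>
           covariance (M N) (\<xi> N v) (\<xi> N w) = 0"
    and local_dep: "\<And>N. N \<ge> 2 \<Longrightarrow> local_dependence (M N) (sk_pairs N) (\<xi> N) (A N) (B N)"
    and eta: "(\<lambda>N. real (dependence_size (sk_pairs N) (A N) (B N))) \<in> o(\<lambda>N. sqrt (real N))"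
  shows "(\<lambda>N. sk_free_energy (M N) N \<beta> (\<xi> N)) \<longlonglongrightarrow> sk_p_infty \<beta>"
proof -
  \<comment> \<open>Constant: \<open>2 * error_bound / N\<close> with
    \<open>c ^ 3 = \<beta> ^ 3 / N^(3/2)\<close> and at most \<open>N^2\<close> pairs gives
    \<open>12 = 2 * 6\<close> and the rate \<open>\<eta> / sqrt N\<close>.\<close>
  have rate: "\<bar>sk_free_energy (M N) N \<beta> (\<xi> N) - sk_gauss_free_energy \<beta> N\<bar>
      \<le> 12 * \<beta> ^ 3 * (\<tau> ^ 3 + 1) * (real (dependence_size (sk_pairs N) (A N) (B N)) / sqrt (real N))"
    if N: "N \<ge> 2" for N
  proof -
    define c where "c = \<beta> / sqrt (real N)"
    define a :: "nat \<times> nat \<Rightarrow> (nat \<Rightarrow> real) \<Rightarrow> real"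
      where "a = (\<lambda>(i, j) \<sigma>. c * (\<sigma> i * \<sigma> j))"
    interpret prob_space "M N"
      using N by (rule prob)
    have c: "c > 0"
      using N beta_pos by (simp add: c_def)
    interpret dependent_gibbs_system "sk_spins N" "sk_pairs N" a c "M N" "\<xi> N" "A N" "B N" "\<tau> ^ 3"
    proof
      show "\<bar>a v \<sigma>\<bar> \<le> c" if v: "v \<in> sk_pairs N" and \<sigma>: "\<sigma> \<in> sk_spins N" for v \<sigma>
      proof -
        obtain i j where ij: "v = (i, j)" "i \<in> {1..N}" "j \<in> {1..N}"
          using v by (auto simp: sk_pairs_def)
        then have "\<sigma> i \<in> {- 1, 1}" "\<sigma> j \<in> {- 1, 1}"
          using \<sigma> unfolding sk_spins_def by blast+
        then show ?thesis
          using c ij(1) by (auto simp: a_def)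
      qed
      \<comment> \<open>Centering turns variance, and below covariance, into raw second
        moments.\<close>
      show "expectation (\<lambda>\<omega>. \<xi> N v \<omega> * \<xi> N v \<omega>) = 1" if "v \<in> sk_pairs N" for v
        using var[OF N that] mean[OF N that] by (simp add: power2_eq_square)
      show "expectation (\<lambda>\<omega>. \<xi> N v \<omega> * \<xi> N w \<omega>) = 0"
        if "v \<in> sk_pairs N" "w \<in> sk_pairs N" "v \<noteq> w" for v w
        using uncorrelated[OF N that] mean[OF N that(1)] mean[OF N that(2)] by (simp add: covariance_def)
    qed (use N c finite_sk_pairs sk_spins_finite sk_spins_nonempty rv integrable mean third_integrable
        third_moment local_dep in auto)
    have Z: "Z x = sk_Z N \<beta> x" for x
      unfolding Z_def weight_def sk_Z_def sk_H_def
      by (intro sum.cong refl arg_cong[where f = exp])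
        (simp add: a_def c_def sum_distrib_left case_prod_unfold mult_ac)
    have G: "G = sk_gauss N"
      by (simp add: sk_gauss_def std_normal_def)
    \<comment> \<open>The sign of \<open>\<tau>\<close> is not assumed. As \<open>N\<close> is at
      least 2 there is some pair, and its third absolute moment shows that \<open>\<tau> ^ 3\<close>
      is nonnegative.\<close>
    have "(1, 2) \<in> sk_pairs N"
      using N by (simp add: sk_pairs_def)
    from third_moment[OF N this] have \<tau>: "\<tau> ^ 3 \<ge> 0"
      by (rule order.trans[rotated]) simp
    have "(\<Sum>v\<in>sk_pairs N. \<Sum>w\<in>A N v. real (card (B N v w)))
        \<le> (\<Sum>v\<in>sk_pairs N. real (dependence_size (sk_pairs N) (A N) (B N)))"
      unfolding of_nat_sum[symmetric]
      by (intro sum_mono of_nat_mono sum_card_le_dependence_size finite_sk_pairs)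
    also have "\<dots> \<le> real N ^ 2 * real (dependence_size (sk_pairs N) (A N) (B N))"
      using card_sk_pairs_le[of N] by (auto intro!: mult_right_mono simp flip: of_nat_power)
    finally have "error_bound \<le> 6 * c ^ 3 * (\<tau> ^ 3 + 1) * (real N ^ 2 * real (dependence_size (sk_pairs N) (A N) (B N)))"
      unfolding error_bound_def using c \<tau> by (intro mult_left_mono) auto
    also have "\<dots> = real N * (6 * \<beta> ^ 3 * (\<tau> ^ 3 + 1) * (real (dependence_size (sk_pairs N) (A N) (B N)) / sqrt (real N)))"
      using N by (simp add: c_def power_divide power3_eq_cube power2_eq_square field_simps)
    finally have "2 * error_bound / real N
        \<le> 12 * \<beta> ^ 3 * (\<tau> ^ 3 + 1) * (real (dependence_size (sk_pairs N) (A N) (B N)) / sqrt (real N))"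
      using N by (simp add: field_simps)
    moreover have "\<bar>sk_free_energy (M N) N \<beta> (\<xi> N) - sk_gauss_free_energy \<beta> N\<bar>
        = \<bar>expectation (\<lambda>\<omega>. ln (Z (\<lambda>v. \<xi> N v \<omega>))) - (\<integral>g. ln (Z g) \<partial>G)\<bar> / real N"
      unfolding sk_free_energy_def sk_gauss_free_energy_def Z G
      by (simp flip: diff_divide_distrib)
    ultimately show ?thesis
      using divide_right_mono[OF abs_ln_Z_gaussian_diff_le, of "real N"] by linarith
  qed
  have "(\<lambda>N. sk_free_energy (M N) N \<beta> (\<xi> N) - sk_gauss_free_energy \<beta> N) \<longlonglongrightarrow> 0"
  proof (rule Lim_null_comparison)
    show "\<forall>\<^sub>F N in sequentially. norm (sk_free_energy (M N) N \<beta> (\<xi> N) - sk_gauss_free_energy \<beta> N)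
        \<le> 12 * \<beta> ^ 3 * (\<tau> ^ 3 + 1) * (real (dependence_size (sk_pairs N) (A N) (B N)) / sqrt (real N))"
      using rate by (auto simp: eventually_sequentially)
    show "(\<lambda>N. 12 * \<beta> ^ 3 * (\<tau> ^ 3 + 1) * (real (dependence_size (sk_pairs N) (A N) (B N)) / sqrt (real N)))
        \<longlonglongrightarrow> 0"
      using tendsto_mult_right_zero[OF smalloD_tendsto[OF eta]] .
  qed
  \<comment> \<open>The assumed convergence is what makes \<open>lim\<close> in
    \<open>sk_p_infty\<close> an actual limit.\<close>
  moreover have "sk_gauss_free_energy \<beta> \<longlonglongrightarrow> sk_p_infty \<beta>"
    using gaussian_limit_exists unfolding sk_p_infty_def by (simp add: convergent_LIMSEQ_iff)
  ultimately show ?thesis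
    using tendsto_add by fastforce
qed

end
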